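(* There are no strings of minimal decay over $\mathbb{A}_1$ (for any frequency $\alpha\in\mathbb{R}$).
   Context: Fix $\ell>0$ and $m>0$. A string is a bounded nonnegative Borel measure $dM$ on $[0,\ell]$. For $z\in\mathbb{C}$, $\varphi(\cdot)=\varphi(\cdot,z;dM)$ is the unique continuous solution on $[0,\ell]$ of $\varphi(x)=1-z^2\int_{[0,x]}(x-s)\varphi(s)\,dM(s)$, and $F(z;dM):=\varphi(\ell,z;dM)-iz\int_{[0,\ell]}\varphi(s,z;dM)\,dM(s)$. The set $\Sigma(dM)$ of quasi-eigenvalues of $dM$ is the set of zeroes of $F(\cdot;dM)$. (For $dM=B\,dx$, these are the $\omega\neq0$ for which $-y''=\omega^2By$, $y'(0)=0$, $y(\ell)=-\frac{i}{\omega}y'(\ell)$ has a nontrivial solution.) The admissible family $\mathbb{A}_1$ is the set of measures $B(x)\,dx$ with $B\in L^1(0,\ell)$, $B\ge0$ a.e. and $\int_0^\ell B\,dx\le m$; $\Sigma[\mathbb{A}_1]:=\bigcup_{dM\in\mathbb{A}_1}\Sigma(dM)$. A number $\alpha\in\mathbb{R}$ is an admissible frequency if $\alpha=\mathrm{Re}\,\omega$ for some $\omega\in\Sigma[\mathbb{A}_1]$. For such $\alpha$, $\beta_{\min}(\alpha;\mathbb{A}_1):=\inf\{\beta\in\mathbb{R}:\alpha-i\beta\in\Sigma[\mathbb{A}_1]\}$. A string $dM\in\mathbb{A}_1$ is of minimal decay for the frequency $\alpha$ over $\mathbb{A}_1$ if $\alpha-i\beta_{\min}(\alpha;\mathbb{A}_1)\in\Sigma(dM)$.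 *)

theory Defs
  imports "HOL-Analysis.Analysis"
begin

definition strings :: "real \<Rightarrow> real measure set" where
  "strings l = {M. finite_measure M \<and> sets M = sets (restrict_space borel {0..l})}"

definition is_phi :: "real \<Rightarrow> real measure \<Rightarrow> complex \<Rightarrow> (real \<Rightarrow> complex) \<Rightarrow> bool" where
  "is_phi l M z f \<longleftrightarrow> continuous_on {0..l} f \<and>
     (\<forall>x\<in>{0..l}. f x = 1 - z\<^sup>2 * (LINT s:{0..x}|M. of_real (x - s) * f s))"

text \<open>Functions are total here, so uniqueness of the solution on \<open>[0, l]\<close> is meant among
  functions normalised off \<open>[0, l]\<close>; \<open>extensional\<close> supplies that normalisation.\<close>

definition phi :: "real \<Rightarrow> real measure \<Rightarrow> complex \<Rightarrow> real \<Rightarrow> complex" where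
  "phi l M z = (THE f. f \<in> extensional {0..l} \<and> is_phi l M z f)"

definition F :: "real \<Rightarrow> real measure \<Rightarrow> complex \<Rightarrow> complex" where
  "F l M z = phi l M z l - \<i> * z * (LINT s:{0..l}|M. phi l M z s)"

definition quasi_eigenvalues :: "real \<Rightarrow> real measure \<Rightarrow> complex set" where
  "quasi_eigenvalues l M = {z. F l M z = 0}"

definition A1 :: "real \<Rightarrow> real \<Rightarrow> real measure set" where
  "A1 l m = {density (restrict_space lborel {0..l}) (\<lambda>x. ennreal (B x)) | B :: real \<Rightarrow> real.
     integrable (restrict_space lborel {0..l}) B \<and>
     (AE x in restrict_space lborel {0..l}. 0 \<le> B x) \<and>
     (LINT x|restrict_space lborel {0..l}. B x) \<le> m}"

lemma A1_subset_strings: "A1 l m \<subseteq> strings l"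
proof
  fix M assume "M \<in> A1 l m"
  then obtain B where B: "integrable (restrict_space lborel {0..l}) B"
    "AE x in restrict_space lborel {0..l}. 0 \<le> B x"
    and M: "M = density (restrict_space lborel {0..l}) (\<lambda>x. ennreal (B x))"
    by (auto simp: A1_def)
  have "emeasure M (space M) = (\<integral>\<^sup>+ x. ennreal (B x) \<partial>restrict_space lborel {0..l})"
    unfolding M using B(1) sets.top[of "restrict_space lborel {0..l}"]
    by (subst emeasure_density) (auto intro!: nn_integral_cong simp: space_restrict_space)
  also have "\<dots> = ennreal (LINT x|restrict_space lborel {0..l}. B x)"
    using B by (rule nn_integral_eq_integral)
  finally have "finite_measure M"
    by (intro finite_measureI) simp
  moreover have "sets M = sets (restrict_space borel {0..l})"
    unfolding M by (simp add: sets_restrict_space)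
  ultimately show "M \<in> strings l"
    by (simp add: strings_def)
qed

definition Sigma_family :: "real \<Rightarrow> real measure set \<Rightarrow> complex set" where
  "Sigma_family l \<A> = (\<Union>M\<in>\<A>. quasi_eigenvalues l M)"

definition admissible_frequency :: "real \<Rightarrow> real measure set \<Rightarrow> real \<Rightarrow> bool" where
  "admissible_frequency l \<A> \<alpha> \<longleftrightarrow> (\<exists>\<omega>\<in>Sigma_family l \<A>. \<alpha> = Re \<omega>)"

text \<open>Only meaningful when \<open>\<alpha>\<close> is an admissible frequency: otherwise this is the \<open>Inf\<close> of the
  empty set, an arbitrary real.\<close>

definition beta_min :: "real \<Rightarrow> real measure set \<Rightarrow> real \<Rightarrow> real" where
  "beta_min l \<A> \<alpha> = Inf {\<beta>. complex_of_real \<alpha> - \<i> * complex_of_real \<beta> \<in> Sigma_family l \<A>}"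

definition minimal_decay :: "real \<Rightarrow> real measure set \<Rightarrow> real \<Rightarrow> real measure \<Rightarrow> bool" where
  "minimal_decay l \<A> \<alpha> M \<longleftrightarrow> admissible_frequency l \<A> \<alpha> \<and> M \<in> \<A> \<and>
     complex_of_real \<alpha> - \<i> * complex_of_real (beta_min l \<A> \<alpha>) \<in> quasi_eigenvalues l M"

end

theory Submission
  imports Defs
begin

text \<open>Let \<open>\<omega>\<close> be a quasi-eigenvalue of the string with density \<open>b\<close>, and let \<open>f\<close> be its solution.
  By Lagrange's identity, \<open>z\<close> is a quasi-eigenvalue for the density \<open>c\<close>, with solution \<open>g\<close>, if and only if
  \<open>z\<^sup>2 * (LINT s|lborel. c s *\<^sub>R (f s * g s)) - \<omega>\<^sup>2 * (LINT s|lborel. b s *\<^sub>R (f s * g s)) + \<i> * (z - \<omega>) * f l * g l = 0\<close>,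
  which to first order is governed by the moments \<open>LINT s|lborel. (c s - b s) *\<^sub>R (f s)\<^sup>2\<close>. These form a
  convex set, and \<open>0\<close> is an interior point of it (in \<open>\<real>\<close> for frequency \<open>0\<close>, where everything is
  real): a supporting line at \<open>0\<close>, given by \<open>\<eta> \<noteq> 0\<close>, would force all the mass of \<open>b\<close> onto the maximum
  set of \<open>Re (\<eta> * (f x)\<^sup>2)\<close>, whereas this function is strictly monotone just to the right of the left end
  of the support of \<open>b\<close>. Hence every \<open>z\<close> near \<open>\<omega>\<close> (on the imaginary axis for frequency \<open>0\<close>) is a
  quasi-eigenvalue of an admissible string, and the decay rate of \<open>\<omega>\<close> can be lowered.\<close>

section \<open>The Volterra equation of a string with a density\<close>

text \<open>Absolute continuity is decisive. A point mass could sit exactly on the maximum set of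
  \<open>Re (\<eta> * (f x)\<^sup>2)\<close>, whereas a density has no atom at the left end of its
  support and therefore has mass in every interval immediately to the right of it. The mass bound
  may be attained, so the competing densities keep the total mass: some of it is moved out of such
  an interval to a better place and spread there over a short interval, so that the result is again
  a density. To first order \<open>g\<close> may be replaced by \<open>f\<close> in the eigenvalue
  equation, which is how the square of \<open>f\<close> arises. The equation itself is Lagrange's
  identity with the boundary condition of \<open>f\<close> inserted; it can be divided by
  \<open>f l\<close> because \<open>f\<close> and its derivative cannot both vanish at
  \<open>l\<close>. That quasi-eigenvalues lie in the open lower half-plane is used twice: it bounds
  the decay rates from below, so that their infimum is meaningful, and it makes
  \<open>\<omega>\<^sup>2\<close> non-real when the frequency is not 0.\<close>

definition densities :: "real \<Rightarrow> real \<Rightarrow> (real \<Rightarrow> real) set" where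
  "densities l m = {b. integrable lborel b \<and> (\<forall>x. 0 \<le> b x) \<and> (\<forall>x. x \<notin> {0..l} \<longrightarrow> b x = 0) \<and>
     (LINT x|lborel. b x) \<le> m}"

text \<open>The factor \<open>max 0 (x - s)\<close> encodes the integration range, so that all
  integrals run over the line against \<open>lborel\<close>; the values of \<open>f\<close> off the
  interval are immaterial because \<open>b\<close> vanishes there. The parameter \<open>q\<close>
  stands for the square of the spectral parameter.\<close>

definition volterra :: "real \<Rightarrow> (real \<Rightarrow> real) \<Rightarrow> complex \<Rightarrow> (real \<Rightarrow> complex) \<Rightarrow> bool" where
  "volterra l b q f \<longleftrightarrow> continuous_on UNIV f \<and>
     (\<forall>x\<in>{0..l}. f x = 1 - q * (LINT s|lborel. b s *\<^sub>R (max 0 (x - s) *\<^sub>R f s)))"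

lemma densitiesD:
  assumes "b \<in> densities l m"
  shows "integrable lborel b" "b \<in> borel_measurable borel" "0 \<le> b x" "x \<notin> {0..l} \<Longrightarrow> b x = 0"
    "(LINT x|lborel. b x) \<le> m" "0 \<le> (LINT x|lborel. b x)" "0 \<le> m"
proof -
  show *: "integrable lborel b" "0 \<le> b x" "x \<notin> {0..l} \<Longrightarrow> b x = 0" "(LINT x|lborel. b x) \<le> m" for x
    using assms by (auto simp: densities_def)
  show "b \<in> borel_measurable borel"
    using borel_measurable_integrable[OF *(1)] by simp
  show "0 \<le> (LINT x|lborel. b x)"
    using * by (intro Bochner_Integration.integral_nonneg) auto
  with *(4) show "0 \<le> m" by linarith
qed

lemma density_integrable:
  fixes g :: "real \<Rightarrow> 'a::{banach, second_countable_topology}"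
  assumes b: "integrable lborel b" "\<And>x. x \<notin> {0..l} \<Longrightarrow> b x = 0"
    and g: "continuous_on UNIV g"
  shows "integrable lborel (\<lambda>s. b s *\<^sub>R g s)"
proof -
  have "compact (g ` {0..l})"
    by (intro compact_continuous_image continuous_on_subset[OF g]) auto
  then obtain C where C: "\<And>x. x \<in> {0..l} \<Longrightarrow> norm (g x) \<le> C"
    using compact_imp_bounded bounded_iff by (metis imageI)
  have [measurable]: "b \<in> borel_measurable borel" "g \<in> borel_measurable borel"
    using borel_measurable_integrable[OF b(1)] borel_measurable_continuous_onI[OF g] by simp_all
  show ?thesis
  proof (rule Bochner_Integration.integrable_bound)
    show "integrable lborel (\<lambda>s. C * b s)"
      using b by simp
    show "AE x in lborel. norm (b x *\<^sub>R g x) \<le> norm (C * b x)"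
    proof (rule AE_I2)
      fix x
      show "norm (b x *\<^sub>R g x) \<le> norm (C * b x)"
      proof (cases "x \<in> {0..l}")
        case True
        then have "norm (g x) \<le> \<bar>C\<bar>"
          using C[OF True] by linarith
        then show ?thesis
          using mult_left_mono[of "norm (g x)" "\<bar>C\<bar>" "\<bar>b x\<bar>"] by (simp add: abs_mult mult.commute)
      qed (simp add: b(2))
    qed
  qed simp
qed

text \<open>The sign of \<open>b\<close> is left free so that the bound also applies to differences
  of two densities.\<close>

lemma density_norm_integral_le:
  fixes g :: "real \<Rightarrow> 'a::{banach, second_countable_topology}"
  assumes b: "integrable lborel b" "\<And>x. x \<notin> {0..l} \<Longrightarrow> b x = 0"
    and C: "\<And>x. x \<in> {0..l} \<Longrightarrow> norm (g x) \<le> C"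
  shows "norm (LINT s|lborel. b s *\<^sub>R g s) \<le> C * (LINT s|lborel. \<bar>b s\<bar>)"
proof -
  have "norm (LINT s|lborel. b s *\<^sub>R g s) \<le> (LINT s|lborel. C * \<bar>b s\<bar>)"
  proof (rule Bochner_Integration.integral_norm_bound[THEN order_trans])
    show "(LINT s|lborel. norm (b s *\<^sub>R g s)) \<le> (LINT s|lborel. C * \<bar>b s\<bar>)"
    proof (rule integral_mono')
      show "integrable lborel (\<lambda>s. C * \<bar>b s\<bar>)"
        using b by simp
      show "norm (b x *\<^sub>R g x) \<le> C * \<bar>b x\<bar>" for x
        using mult_left_mono[OF C[of x], of "\<bar>b x\<bar>"] b(2)[of x]
          by (cases "x \<in> {0..l}") (auto simp: mult.commute)
      show "0 \<le> C * \<bar>b x\<bar>" for x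
        using order_trans[OF norm_ge_zero C[of x]] b(2)[of x] by (cases "x \<in> {0..l}") auto
    qed
  qed
  then show ?thesis by simp
qed

lemma continuous_on_kernel [continuous_intros]:
  fixes g :: "real \<Rightarrow> 'a::real_normed_vector"
  assumes "continuous_on S g"
  shows "continuous_on S (\<lambda>s. max 0 (x - s) *\<^sub>R g s)" "continuous_on S (\<lambda>s. max 0 (s - x) *\<^sub>R g s)"
  using assms by (auto intro!: continuous_intros)

lemma mult_exp_neg_le:
  fixes k t :: real
  assumes "k > 0"
  shows "max 0 t * exp (- (k * t)) \<le> 1 / k"
proof (cases "t \<le> 0")
  case False
  have "k * t \<le> exp (k * t)"
    using exp_ge_add_one_self[of "k * t"] by linarith
  then show ?thesis
    using False assms by (simp add: exp_minus field_simps)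
qed (use assms in simp)

text \<open>Weighting by \<open>exp (- k x)\<close> turns the kernel \<open>x - s\<close> into one bounded by \<open>1 / k\<close>,
  which is why any finite mass is absorbed by a large \<open>k\<close>.\<close>

lemma volterra_gronwall:
  fixes u :: "real \<Rightarrow> real"
  assumes b: "b \<in> densities l m" and u: "continuous_on UNIV u"
    and l: "0 \<le> l" and a: "0 \<le> a" and c: "0 \<le> c"
    and le: "\<And>x. x \<in> {0..l} \<Longrightarrow> u x \<le> a + c * (LINT s|lborel. b s *\<^sub>R (max 0 (x - s) *\<^sub>R u s))"
    and x: "x \<in> {0..l}"
  shows "u x \<le> 2 * a * exp ((2 * c * m + 1) * l)"
proof -
  \<comment> \<open>This gives \<open>c * m / k \<le> 1 / 2\<close>; the summand 1 keeps
    \<open>k\<close> positive when \<open>c * m = 0\<close>.\<close>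
  define k where "k = 2 * c * m + 1"
  note D = densitiesD[OF b]
  have k: "k > 0" "2 * c * m \<le> k"
    using c D(7) by (auto simp: k_def intro: add_nonneg_pos)
  define v where "v x = exp (- (k * x)) * u x" for x
  have "continuous_on {0..l} v"
    unfolding v_def by (intro continuous_intros continuous_on_subset[OF u]) auto
  then obtain y where y: "y \<in> {0..l}" "\<And>x. x \<in> {0..l} \<Longrightarrow> v x \<le> v y"
    using continuous_attains_sup[of "{0..l}" v] l by auto
  \<comment> \<open>At the maximum point \<open>y\<close> each \<open>v s\<close> under the integral
    is at most \<open>v y\<close>, so the inequality closes up as
    \<open>v y \<le> a + v y / 2\<close>.\<close>
  have bound: "v y \<le> 2 * a"
  proof (cases "v y \<le> 0")
    case False
    have "v y \<le> exp (- (k * y)) * (a + c * (LINT s|lborel. b s *\<^sub>R (max 0 (y - s) *\<^sub>R u s)))"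
      unfolding v_def[of y] using le[OF y(1)] by (intro mult_left_mono) auto
    also have "\<dots> = exp (- (k * y)) * a + c * (LINT s|lborel. b s *\<^sub>R (exp (- (k * y)) * (max 0 (y - s) * u s)))"
      by (simp add: algebra_simps flip: integral_mult_right_zero)
    also have "\<dots> \<le> 1 * a + c * (LINT s|lborel. b s * (1 / k * v y))"
    proof (intro add_mono mult_left_mono mult_right_mono integral_mono)
      show "integrable lborel (\<lambda>s. b s *\<^sub>R (exp (- (k * y)) * (max 0 (y - s) * u s)))"
        using D(1,4) by (intro density_integrable[where l = l] continuous_intros u) auto
      fix s
      show "b s *\<^sub>R (exp (- (k * y)) * (max 0 (y - s) * u s)) \<le> b s * (1 / k * v y)"
      proof (cases "s \<in> {0..l}")
        case True
        have "exp (- (k * y)) * (max 0 (y - s) * u s) = (max 0 (y - s) * exp (- (k * (y - s)))) * v s"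
          by (simp add: v_def algebra_simps flip: exp_add)
        also have "\<dots> \<le> (max 0 (y - s) * exp (- (k * (y - s)))) * v y"
          using y(2)[OF True] by (intro mult_left_mono) auto
        also have "\<dots> \<le> 1 / k * v y"
          using mult_exp_neg_le[OF k(1)] False by (intro mult_right_mono) auto
        finally show ?thesis
          unfolding real_scaleR_def by (intro mult_left_mono D(3))
      qed (simp add: D(4))
    qed (use D a c k y(1) in auto)
    also have "\<dots> = a + c * (LINT s|lborel. b s) * (1 / k * v y)"
      by simp
    also have "\<dots> \<le> a + c * m * (1 / k * v y)"
      using D(5) c k False by (intro add_left_mono mult_right_mono mult_left_mono) auto
    also have "\<dots> \<le> a + 1 / 2 * v y"
    proof -
      have "c * m / k \<le> 1 / 2"
        using k by (simp add: field_simps)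
      from mult_right_mono[OF this, of "v y"] show ?thesis
        using False by simp
    qed
    finally show ?thesis by simp
  qed (use a in simp)
  have "u x = exp (k * x) * v x"
    by (simp add: v_def flip: mult.assoc exp_add)
  also have "\<dots> \<le> exp (k * x) * (2 * a)"
    using y(2)[OF x] bound by (intro mult_left_mono) auto
  also have "\<dots> \<le> exp (k * l) * (2 * a)"
    using x k a by (intro mult_right_mono) auto
  finally show ?thesis
    by (simp add: k_def mult.commute mult.left_commute)
qed

lemma volterra_gronwall_zero:
  fixes u :: "real \<Rightarrow> real"
  assumes b: "b \<in> densities l m" and u: "continuous_on UNIV u"
    and l: "0 \<le> l" and c: "0 \<le> c"
    and le: "\<And>x. x \<in> {0..l} \<Longrightarrow> u x \<le> c * (LINT s|lborel. b s *\<^sub>R (max 0 (x - s) *\<^sub>R u s))"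
    and x: "x \<in> {0..l}"
  shows "u x \<le> 0"
  using volterra_gronwall[OF b u l order_refl c _ x] le by simp

lemma densities_reflect:
  assumes b: "b \<in> densities l m"
  shows "(\<lambda>s. b (l - s)) \<in> densities l m"
proof -
  note D = densitiesD[OF b]
  have "integrable lborel (\<lambda>x. b (l - x))"
    using lborel_integrable_real_affine[OF D(1), of "-1" l] by simp
  moreover have "(LINT x|lborel. b (l - x)) = (LINT x|lborel. b x)"
    using lborel_integral_real_affine[of "-1" b l] by simp
  ultimately show ?thesis
    using D by (auto simp: densities_def)
qed

text \<open>The reflection of the interval about its midpoint exchanges the two kernels and
  preserves the class of densities.\<close>

lemma volterra_gronwall_backward:
  fixes u :: "real \<Rightarrow> real"
  assumes b: "b \<in> densities l m" and u: "continuous_on UNIV u"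
    and l: "0 \<le> l" and c: "0 \<le> c"
    and le: "\<And>x. x \<in> {0..l} \<Longrightarrow> u x \<le> c * (LINT s|lborel. b s *\<^sub>R (max 0 (s - x) *\<^sub>R u s))"
    and x: "x \<in> {0..l}"
  shows "u x \<le> 0"
proof -
  have "u (l - (l - x)) \<le> 0"
  proof (rule volterra_gronwall_zero[OF densities_reflect[OF b], where u = "\<lambda>x. u (l - x)"])
    show "continuous_on UNIV (\<lambda>x. u (l - x))"
      by (rule continuous_on_compose2[OF u]) (auto intro!: continuous_intros)
    fix y assume y: "y \<in> {0..l}"
    have "(LINT s|lborel. b s *\<^sub>R (max 0 (s - (l - y)) *\<^sub>R u s)) =
       (LINT s|lborel. b (l - s) *\<^sub>R (max 0 (y - s) *\<^sub>R u (l - s)))"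
      by (subst lborel_integral_real_affine[where c = "-1" and t = l]) (simp_all add: algebra_simps)
    then show "u (l - y) \<le> c * (LINT s|lborel. b (l - s) *\<^sub>R (max 0 (y - s) *\<^sub>R u (l - s)))"
      using le[of "l - y"] y by auto
  qed (use l c x in auto)
  then show ?thesis by simp
qed

text \<open>By compactness of the interval, \<open>K (x, s)\<close> is close to
  \<open>K (y, s)\<close> uniformly in \<open>s\<close> once \<open>x\<close> is near
  \<open>y\<close>; the finite total variation of \<open>b\<close> does the rest.\<close>

lemma density_integral_continuous:
  fixes K :: "'c::t2_space \<times> real \<Rightarrow> 'a::{banach, second_countable_topology}"
  assumes b: "integrable lborel b" "\<And>x. x \<notin> {0..l} \<Longrightarrow> b x = 0"
    and K: "continuous_on UNIV K"
  shows "continuous_on UNIV (\<lambda>y. LINT s|lborel. b s *\<^sub>R K (y, s))"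
proof -
  have "isCont (\<lambda>y. LINT s|lborel. b s *\<^sub>R K (y, s)) y" for y
    unfolding isCont_def
  proof (rule tendstoI)
    fix e :: real assume e: "e > 0"
    define I where "I = (LINT s|lborel. \<bar>b s\<bar>)"
    have I: "I \<ge> 0"
      unfolding I_def by (intro Bochner_Integration.integral_nonneg) auto
    have cont: "continuous_on UNIV (\<lambda>s. K (y, s))" for y
      by (rule continuous_on_compose2[OF K]) (auto intro!: continuous_intros)
    define d where "d = e / (I + 1)"
    have d: "d > 0" "d * I < e"
      using e I by (auto simp: d_def divide_simps)
    obtain X where X: "y \<in> X" "open X" "\<And>x s. x \<in> X \<Longrightarrow> s \<in> {0..l} \<Longrightarrow> dist (K (x, s)) (K (y, s)) \<le> d"
      using continuous_on_prod_compactE[of UNIV "{0..l}" K y d] d(1) continuous_on_subset[OF K]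
      by (metis (no_types, lifting) Int_UNIV_right UNIV_I compact_Icc subset_UNIV)
    have "eventually (\<lambda>x. x \<in> X) (at y)"
      using X(1,2) by (simp add: eventually_at_topological) blast
    then show "\<forall>\<^sub>F x in at y. dist (LINT s|lborel. b s *\<^sub>R K (x, s)) (LINT s|lborel. b s *\<^sub>R K (y, s)) < e"
    proof eventually_elim
      case (elim x)
      have "dist (LINT s|lborel. b s *\<^sub>R K (x, s)) (LINT s|lborel. b s *\<^sub>R K (y, s)) =
          norm (LINT s|lborel. b s *\<^sub>R (K (x, s) - K (y, s)))"
        using density_integrable[OF b cont]
        by (simp add: dist_norm scaleR_diff_right)
      also have "\<dots> \<le> d * I"
        unfolding I_def using X(3)[OF elim] by (intro density_norm_integral_le[OF b]) (auto simp: dist_norm)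
      finally show ?case
        using d by linarith
    qed
  qed
  then show ?thesis
    by (simp add: continuous_at_imp_continuous_on)
qed

text \<open>Banach's fixed point theorem for the unknown \<open>exp (- (k * x)) * f x\<close>. In
  this weighted form the integral operator has contraction constant 1/2, whatever \<open>q\<close>
  and the mass are.\<close>

lemma volterra_exists:
  assumes b: "b \<in> densities l m" and l: "0 < l"
  shows "\<exists>f. volterra l b q f"
proof -
  note D = densitiesD[OF b]
  define k where "k = 2 * norm q * m + 1"
  have k: "k > 0" "2 * norm q * m \<le> k"
    using D(7) by (auto simp: k_def intro: add_nonneg_pos)
  \<comment> \<open>The fixed point is sought among bounded continuous functions on the whole line;
    clamping the argument carries the equation there and makes the image of the operator
    bounded.\<close>
  define cl where "cl x = max 0 (min l x)" for x
  have cl: "cl x \<in> {0..l}" "x \<in> {0..l} \<Longrightarrow> cl x = x" for x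
    using l by (auto simp: cl_def)
  have cl_cont: "continuous_on UNIV cl"
    unfolding cl_def by (intro continuous_intros)
  define p where "p t = max 0 t * exp (- (k * t))" for t
  have p: "0 \<le> p t" "p t \<le> 1 / k" for t
    using mult_exp_neg_le[OF k(1)] by (auto simp: p_def)
  have p_cont: "continuous_on S p" for S
    unfolding p_def by (intro continuous_intros)
  define T where "T g x = of_real (exp (- (k * cl x))) -
    q * (LINT s|lborel. b s *\<^sub>R (p (cl x - s) *\<^sub>R apply_bcontfun g s))" for g and x :: real
  have g_cont: "continuous_on S (apply_bcontfun g)" for g :: "real \<Rightarrow>\<^sub>C complex" and S
    using apply_bcontfun[of g] by (auto simp: bcontfun_def intro: continuous_on_subset)
  have pg_cont: "continuous_on UNIV (\<lambda>s. p (x - s) *\<^sub>R apply_bcontfun g s)"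
    for x and g :: "real \<Rightarrow>\<^sub>C complex"
    by (intro continuous_intros g_cont continuous_on_compose2[OF p_cont[of UNIV]]) auto
  have T: "T g \<in> bcontfun" for g
  proof -
    define J where "J y = of_real (exp (- (k * y))) -
      q * (LINT s|lborel. b s *\<^sub>R (p (y - s) *\<^sub>R apply_bcontfun g s))" for y
    have "continuous_on UNIV (\<lambda>y. LINT s|lborel. b s *\<^sub>R (\<lambda>(y, s). p (y - s) *\<^sub>R apply_bcontfun g s) (y, s))"
      using D(1,4) by (intro density_integral_continuous)
        (auto simp: case_prod_unfold intro!: continuous_intros continuous_on_compose2[OF p_cont[of UNIV]]
           continuous_on_compose2[OF g_cont[of UNIV]])
    then have J: "continuous_on UNIV J"
      unfolding J_def by (intro continuous_intros) auto
    have TJ: "T g = (\<lambda>x. J (cl x))"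
      by (simp add: T_def J_def fun_eq_iff)
    have "compact (J ` {0..l})"
      by (intro compact_continuous_image continuous_on_subset[OF J]) auto
    then have "bounded (J ` {0..l})"
      by (rule compact_imp_bounded)
    then have "bounded (range (T g))"
      by (rule bounded_subset) (use cl in \<open>auto simp: TJ\<close>)
    moreover have "continuous_on UNIV (T g)"
      unfolding TJ by (rule continuous_on_compose2[OF J cl_cont]) auto
    ultimately show ?thesis
      by (simp add: bcontfun_def)
  qed
  have "\<exists>!g. Bcontfun (T g) = g"
  proof (rule banach_fix_type)
    show "\<forall>g h. dist (Bcontfun (T g)) (Bcontfun (T h)) \<le> 1 / 2 * dist g h"
    proof (intro allI dist_bound)
      fix g h :: "real \<Rightarrow>\<^sub>C complex" and x
      have "T g x - T h x = q * (LINT s|lborel. b s *\<^sub>R (p (cl x - s) *\<^sub>R apply_bcontfun h s))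
          - q * (LINT s|lborel. b s *\<^sub>R (p (cl x - s) *\<^sub>R apply_bcontfun g s))"
        by (simp add: T_def)
      also have "\<dots> = q * (LINT s|lborel. b s *\<^sub>R (p (cl x - s) *\<^sub>R apply_bcontfun h s)
          - b s *\<^sub>R (p (cl x - s) *\<^sub>R apply_bcontfun g s))"
        using density_integrable[OF D(1,4) pg_cont] by (simp add: algebra_simps)
      also have "\<dots> = q * (LINT s|lborel. b s *\<^sub>R (p (cl x - s) *\<^sub>R (apply_bcontfun h s - apply_bcontfun g s)))"
        by (simp add: scaleR_diff_right)
      also have "norm \<dots> \<le> norm q * (1 / k * dist g h * (LINT s|lborel. \<bar>b s\<bar>))"
        unfolding norm_mult
      proof (intro mult_left_mono density_norm_integral_le)
        fix s
        have "norm (p (cl x - s) *\<^sub>R (apply_bcontfun h s - apply_bcontfun g s)) \<le>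
            p (cl x - s) * dist g h"
          using p(1) dist_bounded[of g s h] by (simp add: dist_norm norm_minus_commute mult_left_mono)
        also have "\<dots> \<le> 1 / k * dist g h"
          using p(2) by (intro mult_right_mono) auto
        finally show "norm (p (cl x - s) *\<^sub>R (apply_bcontfun h s - apply_bcontfun g s)) \<le> 1 / k * dist g h" .
      qed (use D in auto)
      also have "(LINT s|lborel. \<bar>b s\<bar>) = (LINT s|lborel. b s)"
        using D(3) by simp
      also have "norm q * (1 / k * dist g h * (LINT s|lborel. b s)) \<le> norm q * (1 / k * dist g h * m)"
        using D(5) k by (intro mult_left_mono) auto
      also have "\<dots> = (norm q * m / k) * dist g h"
        by simp
      also have "\<dots> \<le> 1 / 2 * dist g h"
        using k by (intro mult_right_mono) (auto simp: field_simps)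
      finally show "dist (apply_bcontfun (Bcontfun (T g)) x) (apply_bcontfun (Bcontfun (T h)) x) \<le> 1 / 2 * dist g h"
        by (simp add: Bcontfun_inverse T dist_norm)
    qed
  qed auto
  then obtain g where g: "Bcontfun (T g) = g" by blast
  have gT: "apply_bcontfun g x = T g x" for x
    using Bcontfun_inverse[OF T[of g]] g by simp
  \<comment> \<open>Removing the weight: \<open>exp (k * x) * p (x - s)\<close> equals
    \<open>max 0 (x - s) * exp (k * s)\<close>, and the last factor turns \<open>g s\<close> back
    into \<open>f s\<close>.\<close>
  define f where "f x = exp (k * x) *\<^sub>R apply_bcontfun g x" for x
  have "volterra l b q f"
    unfolding volterra_def
  proof (intro conjI ballI)
    show "continuous_on UNIV f"
      unfolding f_def by (intro continuous_intros g_cont)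
    fix x assume x: "x \<in> {0..l}"
    have "f x = exp (k * x) *\<^sub>R (of_real (exp (- (k * x))) -
        q * (LINT s|lborel. b s *\<^sub>R (p (x - s) *\<^sub>R apply_bcontfun g s)))"
      unfolding f_def gT[of x] by (simp only: T_def cl(2)[OF x])
    also have "\<dots> = 1 - q * (LINT s|lborel. exp (k * x) *\<^sub>R (b s *\<^sub>R (p (x - s) *\<^sub>R apply_bcontfun g s)))"
    proof -
      have "exp (k * x) *\<^sub>R (of_real (exp (- (k * x))) :: complex) = 1"
        by (simp add: scaleR_conv_of_real exp_minus)
      then show ?thesis
        by (simp only: scaleR_diff_right mult_scaleR_right integral_scaleR_right)
    qed
    also have "(\<lambda>s. exp (k * x) *\<^sub>R (b s *\<^sub>R (p (x - s) *\<^sub>R apply_bcontfun g s))) =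
       (\<lambda>s. b s *\<^sub>R (max 0 (x - s) *\<^sub>R f s))"
    proof
      fix s
      have "exp (k * s) = exp (k * x) * exp (- (k * (x - s)))"
        unfolding exp_add[symmetric] by (simp add: algebra_simps)
      then show "exp (k * x) *\<^sub>R (b s *\<^sub>R (p (x - s) *\<^sub>R apply_bcontfun g s)) = b s *\<^sub>R (max 0 (x - s) *\<^sub>R f s)"
        unfolding f_def p_def scaleR_scaleR by (simp only: mult_ac)
    qed
    finally show "f x = 1 - q * (LINT s|lborel. b s *\<^sub>R (max 0 (x - s) *\<^sub>R f s))" .
  qed
  then show ?thesis by blast
qed

text \<open>\<open>e\<close> bounds the defect of the old solution \<open>f\<close> in the new
  equation. The difference of the solutions solves the new homogeneous equation up to this defect,
  and Gronwall's inequality applies. Density and spectral parameter may change at the same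
  time.\<close>

lemma volterra_dependence:
  assumes b: "b \<in> densities l m" "b' \<in> densities l m" and l: "0 < l"
    and f: "volterra l b q f" and f': "volterra l b' q' f'"
    and e: "\<And>x. x \<in> {0..l} \<Longrightarrow>
      norm (q' * (LINT s|lborel. b' s *\<^sub>R (max 0 (x - s) *\<^sub>R f s)) - q * (LINT s|lborel. b s *\<^sub>R (max 0 (x - s) *\<^sub>R f s))) \<le> e"
    and Q: "norm q' \<le> Q"
    and x: "x \<in> {0..l}"
  shows "norm (f' x - f x) \<le> 2 * e * exp ((2 * Q * m + 1) * l)"
proof -
  note D = densitiesD[OF b(1)] and D' = densitiesD[OF b(2)]
  have c: "continuous_on UNIV f" "continuous_on UNIV f'"
    using f f' by (auto simp: volterra_def)
  have e0: "0 \<le> e"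
    using order_trans[OF norm_ge_zero e[OF x]] .
  show ?thesis
  proof (rule volterra_gronwall[OF b(2), where u = "\<lambda>x. norm (f' x - f x)" and c = Q])
    show "continuous_on UNIV (\<lambda>x. norm (f' x - f x))"
      using c by (intro continuous_intros)
    fix x assume x: "x \<in> {0..l}"
    let ?I = "\<lambda>b f. LINT s|lborel. b s *\<^sub>R (max 0 (x - s) *\<^sub>R f s)"
    have fx: "f x = 1 - q * ?I b f" "f' x = 1 - q' * ?I b' f'"
      using f f' x unfolding volterra_def by blast+
    have "f' x - f x = - (q' * ?I b' f - q * ?I b f) - q' * (?I b' f' - ?I b' f)"
      unfolding fx right_diff_distrib by simp
    also have "?I b' f' - ?I b' f = ?I b' (\<lambda>s. f' s - f s)"
      using density_integrable[OF D'(1,4) continuous_on_kernel(1)[OF c(1)]]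
        density_integrable[OF D'(1,4) continuous_on_kernel(1)[OF c(2)]]
      by (simp add: scaleR_diff_right)
    finally have eq: "f' x - f x = - (q' * ?I b' f - q * ?I b f) - q' * ?I b' (\<lambda>s. f' s - f s)" .
    show "norm (f' x - f x) \<le> e + Q * (LINT s|lborel. b' s *\<^sub>R (max 0 (x - s) *\<^sub>R norm (f' s - f s)))"
      unfolding eq
    proof (rule order_trans[OF norm_triangle_ineq4], intro add_mono)
      show "norm (- (q' * ?I b' f - q * ?I b f)) \<le> e"
        using e[OF x] unfolding norm_minus_cancel .
      have "norm (b' s *\<^sub>R (max 0 (x - s) *\<^sub>R v)) = b' s *\<^sub>R (max 0 (x - s) *\<^sub>R norm v)" for s and v :: complex
        using D'(3)[of s] by simp
      then have "norm (?I b' (\<lambda>s. f' s - f s)) \<le> (LINT s|lborel. b' s *\<^sub>R (max 0 (x - s) *\<^sub>R norm (f' s - f s)))"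
        using Bochner_Integration.integral_norm_bound[of lborel "\<lambda>s. b' s *\<^sub>R (max 0 (x - s) *\<^sub>R (f' s - f s))"]
        by (simp only:)
      then show "norm (q' * ?I b' (\<lambda>s. f' s - f s)) \<le> Q * (LINT s|lborel. b' s *\<^sub>R (max 0 (x - s) *\<^sub>R norm (f' s - f s)))"
        unfolding norm_mult by (rule mult_mono[OF Q _ order_trans[OF norm_ge_zero Q] norm_ge_zero])
    qed
  next
    show "0 \<le> l" using l by simp
    show "0 \<le> Q" by (rule order_trans[OF norm_ge_zero Q])
  qed (rule e0, rule x)
qed

lemma volterra_unique:
  assumes b: "b \<in> densities l m" and l: "0 < l"
    and f: "volterra l b q f" and f': "volterra l b q f'" and x: "x \<in> {0..l}"
  shows "f' x = f x"
  using volterra_dependence[OF b b l f f', where e = 0 and Q = "norm q"] x by simp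

section \<open>Translation between strings and normalised densities\<close>

definition string_of :: "real \<Rightarrow> (real \<Rightarrow> real) \<Rightarrow> real measure" where
  "string_of l b = density (restrict_space lborel {0..l}) (\<lambda>x. ennreal (b x))"

text \<open>Each string of the family has a representative density that is nonnegative everywhere
  and zero off the interval: the positive part of \<open>B\<close>, cut off. This removes the
  almost-everywhere conditions from the later arguments.\<close>

lemma A1_eq: "A1 l m = string_of l ` densities l m"
proof (intro equalityI subsetI)
  fix M assume "M \<in> A1 l m"
  then obtain B where B: "integrable (restrict_space lborel {0..l}) B"
      "AE x in restrict_space lborel {0..l}. 0 \<le> B x"
      "(LINT x|restrict_space lborel {0..l}. B x) \<le> m"
    and M: "M = density (restrict_space lborel {0..l}) (\<lambda>x. ennreal (B x))"
    by (auto simp: A1_def)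
  define b where "b x = indicator {0..l} x * max 0 (B x)" for x
  have b: "integrable (restrict_space lborel {0..l}) (\<lambda>x. max 0 (B x))"
    using B(1) by (intro integrable_max) auto
  then have int: "integrable lborel b"
    by (subst (asm) integrable_restrict_space) (simp_all add: b_def[abs_def])
  have "(LINT x|lborel. b x) = (LINT x|restrict_space lborel {0..l}. max 0 (B x))"
    by (subst integral_restrict_space) (simp_all add: b_def[abs_def])
  also have "\<dots> = (LINT x|restrict_space lborel {0..l}. B x)"
    using B(2) by (intro integral_cong_AE) (use B(1) b in \<open>auto dest: borel_measurable_integrable\<close>)
  finally have "b \<in> densities l m"
    using int B(3) unfolding b_def[abs_def] by (auto simp: densities_def)
  moreover have "M = string_of l b"
    unfolding M string_of_def
  proof (rule density_cong)
    have "ennreal (B x) = ennreal (b x)" if "x \<in> {0..l}" for x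
      using that by (cases "B x \<ge> 0") (auto simp: b_def ennreal_neg)
    then show "AE x in restrict_space lborel {0..l}. ennreal (B x) = ennreal (b x)"
      by (intro AE_I2) (simp add: space_restrict_space)
    show "(\<lambda>x. ennreal (B x)) \<in> borel_measurable (restrict_space lborel {0..l})"
      using borel_measurable_integrable[OF B(1)] by simp
    show "(\<lambda>x. ennreal (b x)) \<in> borel_measurable (restrict_space lborel {0..l})"
      using borel_measurable_integrable[OF int] by (intro measurable_restrict_space1) simp
  qed
  ultimately show "M \<in> string_of l ` densities l m" by blast
next
  fix M assume "M \<in> string_of l ` densities l m"
  then obtain b where b: "b \<in> densities l m" and M: "M = string_of l b" by blast
  note D = densitiesD[OF b]
  have *: "indicator {0..l} x * b x = b x" for x
    using D(4)[of x] by (auto simp: indicator_def)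
  show "M \<in> A1 l m"
    unfolding A1_def M string_of_def using D
    by (auto intro!: exI[of _ b] simp: integrable_restrict_space integral_restrict_space *)
qed

lemma integral_string_of:
  fixes f :: "real \<Rightarrow> 'a::{banach, second_countable_topology}"
  assumes b: "b \<in> densities l m" and f: "continuous_on {0..l} f" and x: "x \<in> {0..l}"
  shows "(LINT s:{0..x}|string_of l b. f s) = (LINT s|lborel. b s *\<^sub>R (indicator {0..x} s *\<^sub>R f s))"
proof -
  note D = densitiesD[OF b]
  have "{0..x} = {0..x} \<inter> {0..l}" using x by auto
  then have [measurable]: "{0..x} \<in> sets (restrict_space lborel {0..l})"
    by (metis (no_types, lifting) sets_restrict_space_iff borel_closed closed_atLeastAtMost image_eqI inf_commute sets_lborel sets_restrict_space)
  have [measurable]: "f \<in> borel_measurable (restrict_space lborel {0..l})"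
    using borel_measurable_continuous_on_restrict[OF f]
    by (simp add: measurable_def space_restrict_space sets_restrict_space)
  have [measurable]: "b \<in> borel_measurable (restrict_space lborel {0..l})"
    using D(2) by (intro measurable_restrict_space1) simp
  have *: "indicator {0..l} s * (b s * v) = b s * v" for s v
    using D(4)[of s] by (auto simp: indicator_def)
  show ?thesis
    unfolding set_lebesgue_integral_def string_of_def using D(3)
    by (subst integral_density) (auto simp: integral_restrict_space *)
qed

lemma is_phi_iff:
  assumes b: "b \<in> densities l m" and l: "0 < l" and f: "continuous_on {0..l} f"
  shows "is_phi l (string_of l b) z f \<longleftrightarrow>
    (\<forall>x\<in>{0..l}. f x = 1 - z\<^sup>2 * (LINT s|lborel. b s *\<^sub>R (max 0 (x - s) *\<^sub>R f s)))"
proof -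
  have "(LINT s:{0..x}|string_of l b. of_real (x - s) * f s) = (LINT s|lborel. b s *\<^sub>R (max 0 (x - s) *\<^sub>R f s))"
    if "x \<in> {0..l}" for x
    using that f densitiesD(4)[OF b]
    by (subst integral_string_of[OF b])
      (auto intro!: continuous_intros Bochner_Integration.integral_cong simp: indicator_def max_def scaleR_conv_of_real)
  then show ?thesis
    by (simp add: is_phi_def f)
qed

lemma phi_string_of:
  assumes b: "b \<in> densities l m" and l: "0 < l" and f: "volterra l b (z\<^sup>2) f"
  shows "phi l (string_of l b) z = restrict f {0..l}"
  unfolding phi_def
proof (rule the_equality)
  have int: "(LINT s|lborel. b s *\<^sub>R (max 0 (x - s) *\<^sub>R g s)) = (LINT s|lborel. b s *\<^sub>R (max 0 (x - s) *\<^sub>R h s))"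
    if "\<And>s. s \<in> {0..l} \<Longrightarrow> g s = h s" for x and g h :: "real \<Rightarrow> complex"
  proof (rule Bochner_Integration.integral_cong)
    fix s show "b s *\<^sub>R (max 0 (x - s) *\<^sub>R g s) = b s *\<^sub>R (max 0 (x - s) *\<^sub>R h s)"
      using that[of s] densitiesD(4)[OF b, of s] by (cases "s \<in> {0..l}") auto
  qed simp
  have c: "continuous_on {0..l} f" "continuous_on UNIV f"
    using f by (auto simp: volterra_def intro: continuous_on_subset)
  have c': "continuous_on {0..l} (restrict f {0..l})"
    by (rule continuous_on_eq[OF c(1)]) simp
  show "restrict f {0..l} \<in> extensional {0..l} \<and> is_phi l (string_of l b) z (restrict f {0..l})"
    using f int[of "restrict f {0..l}" f] by (auto simp: is_phi_iff[OF b l c'] volterra_def)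
  fix g assume g: "g \<in> extensional {0..l} \<and> is_phi l (string_of l b) z g"
  then have gc: "continuous_on {0..l} g"
    by (simp add: is_phi_def)
  \<comment> \<open>A competitor \<open>g\<close> is constrained only on the interval; clamping its
    argument extends it continuously to the line, so that uniqueness for \<open>volterra\<close> can
    be applied.\<close>
  define h where "h x = g (max 0 (min l x))" for x
  have hg: "x \<in> {0..l} \<Longrightarrow> h x = g x" for x
    by (simp add: h_def)
  have "continuous_on UNIV h"
    unfolding h_def by (rule continuous_on_compose2[OF gc]) (use l in \<open>auto intro!: continuous_intros\<close>)
  then have "volterra l b (z\<^sup>2) h"
    using g is_phi_iff[OF b l gc] hg int[of h g, OF hg] by (auto simp: volterra_def)
  from volterra_unique[OF b l f this] hg have "x \<in> {0..l} \<Longrightarrow> g x = f x" for x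
    by metis
  then show "g = restrict f {0..l}"
    using g by (auto simp: extensional_def fun_eq_iff)
qed

lemma F_string_of:
  assumes b: "b \<in> densities l m" and l: "0 < l" and f: "volterra l b (z\<^sup>2) f"
  shows "F l (string_of l b) z = f l - \<i> * z * (LINT s|lborel. b s *\<^sub>R f s)"
proof -
  have c: "continuous_on {0..l} f"
    using f by (auto simp: volterra_def intro: continuous_on_subset)
  have c': "continuous_on {0..l} (restrict f {0..l})"
    by (rule continuous_on_eq[OF c]) simp
  have "(LINT s:{0..l}|string_of l b. restrict f {0..l} s) = (LINT s|lborel. b s *\<^sub>R f s)"
    using l densitiesD(4)[OF b] by (subst integral_string_of[OF b c'])
      (auto intro!: Bochner_Integration.integral_cong simp: indicator_def)
  then show ?thesis
    using l by (simp add: F_def phi_string_of[OF assms])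
qed

section \<open>Lagrange's identity\<close>

lemma densities_integrable:
  fixes g :: "real \<Rightarrow> 'a::{banach, second_countable_topology}"
  assumes "b \<in> densities l m" "continuous_on UNIV g"
  shows "integrable lborel (\<lambda>s. b s *\<^sub>R g s)"
  using densitiesD(1,4)[OF assms(1)] assms(2) by (rule density_integrable)

text \<open>Exchanging the integrals turns the forward kernel acting on \<open>g\<close> into the
  backward kernel acting on \<open>f\<close>. This takes the place of integration by parts in
  Lagrange's identity.\<close>

lemma density_Fubini:
  fixes f g :: "real \<Rightarrow> complex"
  assumes b: "b \<in> densities l m" "b' \<in> densities l m"
    and f: "continuous_on UNIV f" and g: "continuous_on UNIV g"
  shows "(LINT x|lborel. b x *\<^sub>R (f x * (LINT s|lborel. b' s *\<^sub>R (max 0 (x - s) *\<^sub>R g s)))) =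
    (LINT s|lborel. b' s *\<^sub>R (g s * (LINT x|lborel. b x *\<^sub>R (max 0 (x - s) *\<^sub>R f x))))"
proof -
  note D = densitiesD[OF b(1)] and D' = densitiesD[OF b(2)]
  define H where "H x s = b x *\<^sub>R (f x * (b' s *\<^sub>R (max 0 (x - s) *\<^sub>R g s)))" for x s
  note [measurable] = D(2) D'(2) borel_measurable_continuous_onI[OF f] borel_measurable_continuous_onI[OF g]
  have 1: "integrable (lborel \<Otimes>\<^sub>M lborel) (case_prod H)"
  proof (rule lborel_pair.Fubini_integrable)
    show "case_prod H \<in> borel_measurable (lborel \<Otimes>\<^sub>M lborel)"
      unfolding H_def by measurable
    have "continuous_on UNIV (\<lambda>x. LINT s|lborel. b' s *\<^sub>R (\<lambda>(x, s). max 0 (x - s) * norm (g s)) (x, s))"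
      using D'(1,4) by (intro density_integral_continuous)
        (auto simp: case_prod_unfold intro!: continuous_intros continuous_on_compose2[OF g])
    then have "integrable lborel (\<lambda>x. b x *\<^sub>R (norm (f x) * (LINT s|lborel. b' s *\<^sub>R (max 0 (x - s) * norm (g s)))))"
      using D(1,4) by (intro density_integrable) (auto intro!: continuous_intros f)
    moreover have "(LINT s|lborel. norm (H x s)) = b x *\<^sub>R (norm (f x) * (LINT s|lborel. b' s *\<^sub>R (max 0 (x - s) * norm (g s))))" for x
    proof -
      have "norm (H x s) = (b x * norm (f x)) * (b' s *\<^sub>R (max 0 (x - s) * norm (g s)))" for s
        using D(3)[of x] D'(3)[of s] by (simp add: H_def norm_mult)
      then show ?thesis by simp
    qed
    ultimately show "integrable lborel (\<lambda>x. LINT s|lborel. norm (case (x, s) of (x, s) \<Rightarrow> H x s))"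
      by simp
    have "integrable lborel (\<lambda>s. b' s *\<^sub>R (max 0 (x - s) *\<^sub>R g s))" for x
      using D'(1,4) by (intro density_integrable continuous_intros g) auto
    then show "AE x in lborel. integrable lborel (\<lambda>y. case (x, y) of (x, s) \<Rightarrow> H x s)"
      unfolding H_def prod.case by (intro AE_I2 integrable_scaleR_right integrable_mult_right)
  qed
  have "(LINT x|lborel. (LINT s|lborel. H x s)) = (LINT s|lborel. (LINT x|lborel. H x s))"
    using lborel_pair.Fubini_integral[OF 1] by simp
  moreover have "(LINT s|lborel. H x s) = b x *\<^sub>R (f x * (LINT s|lborel. b' s *\<^sub>R (max 0 (x - s) *\<^sub>R g s)))" for x
    unfolding H_def by (simp only: integral_scaleR_right integral_mult_right_zero)
  moreover have "(LINT x|lborel. H x s) = b' s *\<^sub>R (g s * (LINT x|lborel. b x *\<^sub>R (max 0 (x - s) *\<^sub>R f x)))" for s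
  proof -
    have "H x s = b' s *\<^sub>R (g s * (b x *\<^sub>R (max 0 (x - s) *\<^sub>R f x)))" for x
      by (simp add: H_def mult_ac)
    then show ?thesis
      by (simp only: integral_scaleR_right integral_mult_right_zero)
  qed
  ultimately show ?thesis
    by (simp only:)
qed

text \<open>Since \<open>max 0 t - max 0 (- t) = t\<close>, the forward and backward kernels differ
  by \<open>x - s\<close>, whose integral depends on two moments only.\<close>

lemma kernel_decompose:
  fixes f :: "real \<Rightarrow> complex"
  assumes b: "b \<in> densities l m" and f: "continuous_on UNIV f"
  shows "(LINT s|lborel. b s *\<^sub>R (max 0 (x - s) *\<^sub>R f s)) - (LINT s|lborel. b s *\<^sub>R (max 0 (s - x) *\<^sub>R f s)) =
     x *\<^sub>R (LINT s|lborel. b s *\<^sub>R f s) - (LINT s|lborel. b s *\<^sub>R (s *\<^sub>R f s))"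
proof -
  note D = densitiesD[OF b]
  have i: "integrable lborel (\<lambda>s. b s *\<^sub>R (max 0 (x - s) *\<^sub>R f s))"
     "integrable lborel (\<lambda>s. b s *\<^sub>R (max 0 (s - x) *\<^sub>R f s))"
     "integrable lborel (\<lambda>s. b s *\<^sub>R f s)" "integrable lborel (\<lambda>s. b s *\<^sub>R (s *\<^sub>R f s))"
    by (intro densities_integrable[OF b] continuous_intros f)+
  have *: "b s *\<^sub>R (max 0 (x - s) *\<^sub>R f s) - b s *\<^sub>R (max 0 (s - x) *\<^sub>R f s) =
      x *\<^sub>R (b s *\<^sub>R f s) - b s *\<^sub>R (s *\<^sub>R f s)" for s
    by (simp add: max_def algebra_simps)
  have "(LINT s|lborel. b s *\<^sub>R (max 0 (x - s) *\<^sub>R f s)) - (LINT s|lborel. b s *\<^sub>R (max 0 (s - x) *\<^sub>R f s)) =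
     (LINT s|lborel. x *\<^sub>R (b s *\<^sub>R f s) - b s *\<^sub>R (s *\<^sub>R f s))"
    unfolding *[symmetric] by (rule Bochner_Integration.integral_diff[OF i(1,2), symmetric])
  also have "\<dots> = x *\<^sub>R (LINT s|lborel. b s *\<^sub>R f s) - (LINT s|lborel. b s *\<^sub>R (s *\<^sub>R f s))"
    using Bochner_Integration.integral_diff[OF integrable_scaleR_right[OF i(3), of x] i(4)]
    by (simp only: integral_scaleR_right)
  finally show ?thesis .
qed

lemma kernel_outside:
  fixes f :: "real \<Rightarrow> complex"
  assumes b: "b \<in> densities l m"
  shows "(LINT s|lborel. b s *\<^sub>R (max 0 (s - l) *\<^sub>R f s)) = 0"
    "(LINT s|lborel. b s *\<^sub>R (max 0 (0 - s) *\<^sub>R f s)) = 0"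
proof -
  have "b s *\<^sub>R (max 0 (s - l) *\<^sub>R f s) = 0" "b s *\<^sub>R (max 0 (0 - s) *\<^sub>R f s) = 0" for s
    using densitiesD(4)[OF b, of s] by (cases "s \<in> {0..l}"; simp)+
  then show "(LINT s|lborel. b s *\<^sub>R (max 0 (s - l) *\<^sub>R f s)) = 0"
    "(LINT s|lborel. b s *\<^sub>R (max 0 (0 - s) *\<^sub>R f s)) = 0"
    by (simp_all only: integral_zero)
qed

lemma volterra_continuous: "volterra l b q f \<Longrightarrow> continuous_on UNIV f"
  by (simp add: volterra_def)

lemma volterra_eq:
  "volterra l b q f \<Longrightarrow> x \<in> {0..l} \<Longrightarrow> f x = 1 - q * (LINT s|lborel. b s *\<^sub>R (max 0 (x - s) *\<^sub>R f s))"
  by (simp add: volterra_def)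

lemma volterra_0:
  assumes "b \<in> densities l m" "volterra l b q f" "0 < l"
  shows "f 0 = 1"
  using volterra_eq[OF assms(2), of 0] kernel_outside(2)[OF assms(1), of f] assms(3) by simp

text \<open>The integrated form of \<open>(f g' - f' g)' = (q b - q' b') f g\<close>, with
  \<open>f' l = - q * (LINT s|lborel. b s *\<^sub>R f s)\<close>.\<close>

lemma lagrange_identity:
  assumes b: "b \<in> densities l m" "b' \<in> densities l m" and l: "0 < l"
    and f: "volterra l b q f" and g: "volterra l b' q' g"
  shows "f l * (q' * (LINT s|lborel. b' s *\<^sub>R g s)) - g l * (q * (LINT s|lborel. b s *\<^sub>R f s)) =
    q' * (LINT s|lborel. b' s *\<^sub>R (f s * g s)) - q * (LINT s|lborel. b s *\<^sub>R (f s * g s))"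
proof -
  note D = densitiesD[OF b(1)] and D' = densitiesD[OF b(2)]
  note fc = volterra_continuous[OF f] and gc = volterra_continuous[OF g]
  define A where "A = (LINT s|lborel. b s *\<^sub>R f s)"
  define A1 where "A1 = (LINT s|lborel. b s *\<^sub>R (s *\<^sub>R f s))"
  define B where "B = (LINT s|lborel. b' s *\<^sub>R g s)"
  define B1 where "B1 = (LINT s|lborel. b' s *\<^sub>R (s *\<^sub>R g s))"
  define P where "P x = (LINT s|lborel. b s *\<^sub>R (max 0 (x - s) *\<^sub>R f s))" for x
  define P' where "P' x = (LINT s|lborel. b s *\<^sub>R (max 0 (s - x) *\<^sub>R f s))" for x
  define R where "R x = (LINT s|lborel. b' s *\<^sub>R (max 0 (x - s) *\<^sub>R g s))" for x
  have cont: "continuous_on UNIV (\<lambda>x. LINT s|lborel. c s *\<^sub>R (max 0 (x - s) *\<^sub>R h s))"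
    "continuous_on UNIV (\<lambda>x. LINT s|lborel. c s *\<^sub>R (max 0 (s - x) *\<^sub>R h s))"
    if c: "c \<in> densities l m" and h: "continuous_on UNIV h" for c and h :: "real \<Rightarrow> complex"
  proof -
    have "continuous_on UNIV (\<lambda>x. LINT s|lborel. c s *\<^sub>R (\<lambda>(x, s). max 0 (x - s) *\<^sub>R h s) (x, s))"
      "continuous_on UNIV (\<lambda>x. LINT s|lborel. c s *\<^sub>R (\<lambda>(x, s). max 0 (s - x) *\<^sub>R h s) (x, s))"
      using densitiesD(1,4)[OF c] by (intro density_integral_continuous;
        force simp: case_prod_unfold intro!: continuous_intros continuous_on_compose2[OF h])+
    then show "continuous_on UNIV (\<lambda>x. LINT s|lborel. c s *\<^sub>R (max 0 (x - s) *\<^sub>R h s))"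
      "continuous_on UNIV (\<lambda>x. LINT s|lborel. c s *\<^sub>R (max 0 (s - x) *\<^sub>R h s))" by simp_all
  qed
  have Pc: "continuous_on UNIV P" "continuous_on UNIV P'" "continuous_on UNIV R"
    unfolding P_def[abs_def] P'_def[abs_def] R_def[abs_def] using cont b fc gc by blast+
  have PP: "P x - P' x = x *\<^sub>R A - A1" for x
    unfolding P_def P'_def A_def A1_def by (rule kernel_decompose[OF b(1) fc])
  have fl: "f l = 1 - q * (l *\<^sub>R A - A1)"
  proof -
    have "P' l = 0"
      unfolding P'_def by (rule kernel_outside(1)[OF b(1)])
    then show ?thesis
      using volterra_eq[OF f, of l] l PP[of l] by (simp add: P_def)
  qed
  have gl: "g l = 1 - q' * (l *\<^sub>R B - B1)"
    using volterra_eq[OF g, of l] l kernel_decompose[OF b(2) gc, of l] kernel_outside(1)[OF b(2), of g]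
    by (simp add: B_def B1_def)
  \<comment> \<open>\<open>X\<close> and \<open>Y\<close> are the two mixed double integrals. After
    Fubini \<open>Y\<close> carries the backward kernel, so that \<open>X - Y\<close> only involves
    the kernel \<open>x - s\<close> and factors into moments.\<close>
  define X where "X = (LINT x|lborel. b' x *\<^sub>R (g x * P x))"
  define Y where "Y = (LINT x|lborel. b x *\<^sub>R (f x * R x))"
  have "Y = (LINT s|lborel. b' s *\<^sub>R (g s * P' s))"
    unfolding Y_def R_def P'_def by (rule density_Fubini[OF b fc gc])
  then have "X - Y = (LINT x|lborel. b' x *\<^sub>R (g x * P x)) - (LINT x|lborel. b' x *\<^sub>R (g x * P' x))"
    by (simp add: X_def)
  also have "\<dots> = (LINT x|lborel. b' x *\<^sub>R (g x * P x) - b' x *\<^sub>R (g x * P' x))"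
    using D'(1,4) by (intro Bochner_Integration.integral_diff[symmetric] density_integrable continuous_intros gc Pc) auto
  also have "(\<lambda>x. b' x *\<^sub>R (g x * P x) - b' x *\<^sub>R (g x * P' x)) = (\<lambda>x. A * (b' x *\<^sub>R (x *\<^sub>R g x)) - A1 * (b' x *\<^sub>R g x))"
  proof
    fix x
    have "b' x *\<^sub>R (g x * P x) - b' x *\<^sub>R (g x * P' x) = b' x *\<^sub>R (g x * (P x - P' x))"
      by (simp add: algebra_simps)
    then show "b' x *\<^sub>R (g x * P x) - b' x *\<^sub>R (g x * P' x) = A * (b' x *\<^sub>R (x *\<^sub>R g x)) - A1 * (b' x *\<^sub>R g x)"
      unfolding PP by (simp add: algebra_simps)
  qed
  also have "(LINT x|lborel. A * (b' x *\<^sub>R (x *\<^sub>R g x)) - A1 * (b' x *\<^sub>R g x)) = A * B1 - A1 * B"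
  proof -
    have i: "integrable lborel (\<lambda>x. b' x *\<^sub>R (x *\<^sub>R g x))" "integrable lborel (\<lambda>x. b' x *\<^sub>R g x)"
      by (intro densities_integrable[OF b(2)] continuous_intros gc)+
    then show ?thesis
      unfolding B_def B1_def using integrable_mult_right[OF i(1), of A] integrable_mult_right[OF i(2), of A1]
      by (simp only: Bochner_Integration.integral_diff integral_mult_right_zero)
  qed
  finally have XY: "X - Y = A * B1 - A1 * B" .
  have restr: "(LINT s|lborel. c s *\<^sub>R h s) = (LINT s|lborel. c s *\<^sub>R h' s)"
    if "c \<in> densities l m" "\<And>s. s \<in> {0..l} \<Longrightarrow> h s = h' s" for c and h h' :: "real \<Rightarrow> complex"
  proof -
    have "c s *\<^sub>R h s = c s *\<^sub>R h' s" for s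
      using that(2)[of s] densitiesD(4)[OF that(1), of s] by (cases "s \<in> {0..l}") auto
    then show ?thesis by (simp only:)
  qed
  \<comment> \<open>In the integral against \<open>b'\<close> the factor \<open>f\<close> is
    replaced by the right-hand side of its equation, in the one against \<open>b\<close> the factor
    \<open>g\<close>. What remains is algebra in the moments.\<close>
  have IX: "(LINT s|lborel. b' s *\<^sub>R (f s * g s)) = B - q * X"
  proof -
    have "f s * g s = g s - q * (g s * P s)" if "s \<in> {0..l}" for s
      unfolding volterra_eq[OF f that] P_def[symmetric] by (simp add: algebra_simps)
    then have "(LINT s|lborel. b' s *\<^sub>R (f s * g s)) = (LINT s|lborel. b' s *\<^sub>R (g s - q * (g s * P s)))"
      by (rule restr[OF b(2)])
    also have "\<dots> = (LINT s|lborel. b' s *\<^sub>R g s - q * (b' s *\<^sub>R (g s * P s)))"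
      by (simp add: algebra_simps)
    also have "\<dots> = (LINT s|lborel. b' s *\<^sub>R g s) - (LINT s|lborel. q * (b' s *\<^sub>R (g s * P s)))"
      using D'(1,4) by (intro Bochner_Integration.integral_diff integrable_mult_right density_integrable continuous_intros gc Pc) auto
    finally show ?thesis by (simp only: B_def X_def integral_mult_right_zero)
  qed
  have IY: "(LINT s|lborel. b s *\<^sub>R (f s * g s)) = A - q' * Y"
  proof -
    have "f s * g s = f s - q' * (f s * R s)" if "s \<in> {0..l}" for s
      unfolding volterra_eq[OF g that] R_def[symmetric] by (simp add: algebra_simps)
    then have "(LINT s|lborel. b s *\<^sub>R (f s * g s)) = (LINT s|lborel. b s *\<^sub>R (f s - q' * (f s * R s)))"
      by (rule restr[OF b(1)])
    also have "\<dots> = (LINT s|lborel. b s *\<^sub>R f s - q' * (b s *\<^sub>R (f s * R s)))"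
      by (simp add: algebra_simps)
    also have "\<dots> = (LINT s|lborel. b s *\<^sub>R f s) - (LINT s|lborel. q' * (b s *\<^sub>R (f s * R s)))"
      using D(1,4) by (intro Bochner_Integration.integral_diff integrable_mult_right density_integrable continuous_intros fc Pc) auto
    finally show ?thesis by (simp only: A_def Y_def integral_mult_right_zero)
  qed
  have X: "X = Y + (A * B1 - A1 * B)"
    using XY by (simp add: algebra_simps)
  show ?thesis
    unfolding IX IY fl gl A_def[symmetric] B_def[symmetric] X
    by (simp add: algebra_simps scaleR_conv_of_real)
qed

text \<open>With zero value and zero derivative at \<open>l\<close>, the equation read from the
  right end is homogeneous, so backward Gronwall makes the solution vanish, against
  \<open>f 0 = 1\<close>.\<close>

lemma volterra_not_both_zero:
  assumes b: "b \<in> densities l m" and l: "0 < l" and f: "volterra l b q f"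
    and fl: "f l = 0" and fl': "(LINT s|lborel. b s *\<^sub>R f s) = 0"
  shows False
proof -
  note D = densitiesD[OF b] and fc = volterra_continuous[OF f]
  have "norm (f 0) \<le> 0"
  proof (rule volterra_gronwall_backward[OF b, where c = "norm q" and u = "\<lambda>x. norm (f x)"])
    show "continuous_on UNIV (\<lambda>x. norm (f x))"
      by (intro continuous_intros fc)
    fix x assume x: "x \<in> {0..l}"
    define P' where "P' x = (LINT s|lborel. b s *\<^sub>R (max 0 (s - x) *\<^sub>R f s))" for x
    define P where "P x = (LINT s|lborel. b s *\<^sub>R (max 0 (x - s) *\<^sub>R f s))" for x
    \<comment> \<open>As the zeroth moment of \<open>b f\<close> vanishes,
      \<open>kernel_decompose\<close> yields the same value at \<open>x\<close> and at
      \<open>l\<close>, and the backward integral is 0 at \<open>l\<close>.\<close>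
    have "P x - P' x = P l"
      using kernel_decompose[OF b fc, of x] kernel_decompose[OF b fc, of l] kernel_outside(1)[OF b, of f]
      unfolding P_def P'_def fl' by simp
    moreover have "f x - f l = q * (P l - P x)"
      using volterra_eq[OF f x] volterra_eq[OF f, of l] l
      unfolding P_def by (simp add: algebra_simps)
    ultimately have "f x - f l = - q * P' x"
      by (simp add: algebra_simps)
    moreover have "norm (P' x) \<le> (LINT s|lborel. norm (b s *\<^sub>R (max 0 (s - x) *\<^sub>R f s)))"
      unfolding P'_def by (rule Bochner_Integration.integral_norm_bound)
    moreover have "norm (b s *\<^sub>R (max 0 (s - x) *\<^sub>R f s)) = b s *\<^sub>R (max 0 (s - x) *\<^sub>R norm (f s))" for s
      using D(3)[of s] by simp
    ultimately show "norm (f x) \<le> norm q * (LINT s|lborel. b s *\<^sub>R (max 0 (s - x) *\<^sub>R norm (f s)))"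
      unfolding fl diff_zero by (simp only: norm_mult norm_minus_cancel mult_left_mono norm_ge_zero)
  qed (use l in auto)
  then show False
    using volterra_0[OF b f l] by simp
qed

lemma volterra_cnj:
  assumes "volterra l b q f"
  shows "volterra l b (cnj q) (\<lambda>x. cnj (f x))"
  unfolding volterra_def
proof (intro conjI ballI)
  show "continuous_on UNIV (\<lambda>x. cnj (f x))"
    by (intro continuous_intros volterra_continuous[OF assms])
  fix x assume x: "x \<in> {0..l}"
  have "cnj (LINT s|lborel. b s *\<^sub>R (max 0 (x - s) *\<^sub>R f s)) = (LINT s|lborel. b s *\<^sub>R (max 0 (x - s) *\<^sub>R cnj (f s)))"
    by (subst Bochner_Integration.integral_cnj[symmetric])
      (simp del: Bochner_Integration.integral_cnj)
  then show "cnj (f x) = 1 - cnj q * (LINT s|lborel. b s *\<^sub>R (max 0 (x - s) *\<^sub>R cnj (f s)))"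
    unfolding volterra_eq[OF assms x] by simp
qed

text \<open>The conjugate solves the same equation, so uniqueness applies.\<close>

lemma volterra_real:
  assumes b: "b \<in> densities l m" and l: "0 < l" and f: "volterra l b (of_real c) f" and x: "x \<in> {0..l}"
  shows "Im (f x) = 0"
  using volterra_unique[OF b l f _ x, of "\<lambda>x. cnj (f x)"] volterra_cnj[OF f]
  by (metis complex_cnj_complex_of_real Reals_cnj_iff complex_is_Real_iff)

text \<open>The negative part of \<open>Re f\<close> satisfies a homogeneous Gronwall inequality and
  therefore vanishes. The integral term in the equation is then nonnegative, and \<open>Re f\<close>
  is at least its constant term.\<close>

lemma volterra_ge_1:
  assumes b: "b \<in> densities l m" and l: "0 < l" and c: "0 \<le> c"
    and f: "volterra l b (- of_real c) f" and x: "x \<in> {0..l}"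
  shows "1 \<le> Re (f x)"
proof -
  note D = densitiesD[OF b] and fc = volterra_continuous[OF f]
  have i: "integrable lborel (\<lambda>s. b s *\<^sub>R (max 0 (x - s) *\<^sub>R f s))" for x
    by (intro densities_integrable[OF b] continuous_intros fc)
  have Ref: "Re (f x) = 1 + c * (LINT s|lborel. b s * (max 0 (x - s) * Re (f s)))" if "x \<in> {0..l}" for x
    using volterra_eq[OF f that] integral_Re[OF i[of x]] by (simp del: scaleR_scaleR)
  define u where "u x = max 0 (- Re (f x))" for x
  have uc: "continuous_on UNIV u"
    unfolding u_def by (intro continuous_intros fc)
  have "u y \<le> c * (LINT s|lborel. b s *\<^sub>R (max 0 (y - s) *\<^sub>R u s))" if y: "y \<in> {0..l}" for y
  proof -
    have "- (LINT s|lborel. b s * (max 0 (y - s) * Re (f s))) = (LINT s|lborel. - (b s * (max 0 (y - s) * Re (f s))))"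
      by simp
    also have "\<dots> \<le> (LINT s|lborel. b s *\<^sub>R (max 0 (y - s) *\<^sub>R u s))"
    proof (rule integral_mono)
      show "integrable lborel (\<lambda>s. - (b s * (max 0 (y - s) * Re (f s))))"
        using integrable_Re[OF i[of y]] by (simp del: scaleR_scaleR)
      show "integrable lborel (\<lambda>s. b s *\<^sub>R (max 0 (y - s) *\<^sub>R u s))"
        using D(1,4) by (intro density_integrable continuous_intros uc) auto
      fix s
      have "(b s * max 0 (y - s)) * (- Re (f s)) \<le> (b s * max 0 (y - s)) * u s"
        using D(3) by (intro mult_left_mono) (auto simp: u_def)
      then show "- (b s * (max 0 (y - s) * Re (f s))) \<le> b s *\<^sub>R (max 0 (y - s) *\<^sub>R u s)"
        by (simp add: mult.assoc)
    qed
    finally have "- Re (f y) \<le> c * (LINT s|lborel. b s *\<^sub>R (max 0 (y - s) *\<^sub>R u s))"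
      using mult_left_mono[of _ _ c] c unfolding Ref[OF y] by fastforce
    moreover have "0 \<le> c * (LINT s|lborel. b s *\<^sub>R (max 0 (y - s) *\<^sub>R u s))"
      using c D(3) by (intro mult_nonneg_nonneg Bochner_Integration.integral_nonneg) (auto simp: u_def)
    ultimately show ?thesis by (simp add: u_def)
  qed
  then have "u y \<le> 0" if "y \<in> {0..l}" for y
    using volterra_gronwall_zero[OF b uc _ c _ that] l by auto
  then have pos: "0 \<le> Re (f y)" if "y \<in> {0..l}" for y
    using that by (force simp: u_def)
  have "0 \<le> b s * (max 0 (x - s) * Re (f s))" for s
    using pos[of s] D(3,4)[of s] by (cases "s \<in> {0..l}") auto
  then have "0 \<le> (LINT s|lborel. b s * (max 0 (x - s) * Re (f s)))"
    by (intro Bochner_Integration.integral_nonneg) auto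
  then show ?thesis
    using Ref[OF x] c by simp
qed

lemma volterra_bounded:
  assumes "volterra l b q f"
  obtains K where "\<And>x. x \<in> {0..l} \<Longrightarrow> norm (f x) \<le> K"
proof -
  have "compact (f ` {0..l})"
    using volterra_continuous[OF assms] by (intro compact_continuous_image) (auto intro: continuous_on_subset)
  then show ?thesis
    using compact_imp_bounded bounded_iff that by (metis imageI)
qed

section \<open>Boundary condition and location of the quasi-eigenvalues\<close>

lemma quasi_eigenvalue_iff:
  assumes "b \<in> densities l m" "0 < l" "volterra l b (z\<^sup>2) f"
  shows "z \<in> quasi_eigenvalues l (string_of l b) \<longleftrightarrow> f l = \<i> * z * (LINT s|lborel. b s *\<^sub>R f s)"
  by (simp add: quasi_eigenvalues_def F_string_of[OF assms])

text \<open>The boundary condition ties the value at \<open>l\<close> to the derivative there: if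
  the value were 0, both would vanish. Without mass, or for \<open>z = 0\<close>, the right-hand
  side of the condition is 0 as well.\<close>

lemma quasi_eigenvalue_end:
  assumes b: "b \<in> densities l m" and l: "0 < l" and f: "volterra l b (z\<^sup>2) f"
    and z: "z \<in> quasi_eigenvalues l (string_of l b)"
  shows "f l \<noteq> 0" "z \<noteq> 0" "0 < (LINT s|lborel. b s)"
proof -
  note D = densitiesD[OF b]
  have e: "f l = \<i> * z * (LINT s|lborel. b s *\<^sub>R f s)"
    using z quasi_eigenvalue_iff[OF b l f] by simp
  show z0: "z \<noteq> 0"
  proof
    assume "z = 0"
    moreover from this have "f l = 1"
      using volterra_eq[OF f, of l] l by simp
    ultimately show False using e by simp
  qed
  show fl: "f l \<noteq> 0"
    using volterra_not_both_zero[OF b l f] e z0 by auto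
  show "0 < (LINT s|lborel. b s)"
  proof (rule ccontr)
    assume "\<not> ?thesis"
    then have "(LINT s|lborel. b s) = 0"
      using D(6) by linarith
    then have "(LINT s|lborel. \<bar>b s\<bar>) = 0"
      using D(3) by simp
    moreover obtain K where "\<And>x. x \<in> {0..l} \<Longrightarrow> norm (f x) \<le> K"
      using volterra_bounded[OF f] by blast
    ultimately have "norm (LINT s|lborel. b s *\<^sub>R f s) \<le> 0"
      using density_norm_integral_le[OF D(1,4), of l f K] by auto
    then show False
      using e fl by simp
  qed
qed

text \<open>The equation is what Lagrange's identity becomes when the boundary conditions at
  \<open>z\<close> and \<open>z'\<close> are inserted. Conversely, once the condition for
  \<open>f\<close> is known, dividing by \<open>f l * z'\<close> isolates the condition for
  \<open>g\<close>.\<close>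

lemma quasi_eigenvalueI:
  assumes b: "b \<in> densities l m" "b' \<in> densities l m" and l: "0 < l"
    and f: "volterra l b (z\<^sup>2) f" and g: "volterra l b' (z'\<^sup>2) g"
    and z: "z \<in> quasi_eigenvalues l (string_of l b)" and z': "z' \<noteq> 0"
    and eq: "z'\<^sup>2 * (LINT s|lborel. b' s *\<^sub>R (f s * g s)) - z\<^sup>2 * (LINT s|lborel. b s *\<^sub>R (f s * g s)) +
      \<i> * (z' - z) * f l * g l = 0"
  shows "z' \<in> quasi_eigenvalues l (string_of l b')"
proof -
  define A where "A = (LINT s|lborel. b s *\<^sub>R f s)"
  define B where "B = (LINT s|lborel. b' s *\<^sub>R g s)"
  have fl: "f l = \<i> * z * A"
    using z quasi_eigenvalue_iff[OF b(1) l f] by (simp add: A_def)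
  have "f l * (z'\<^sup>2 * B) - g l * (z\<^sup>2 * A) + \<i> * (z' - z) * f l * g l = 0"
    using lagrange_identity[OF b l f g] eq unfolding A_def B_def by simp
  moreover have "g l * (z\<^sup>2 * A) = - \<i> * z * f l * g l"
    unfolding fl by (simp add: power2_eq_square algebra_simps)
  ultimately have "f l * (z' * (z' * B + \<i> * g l)) = 0"
    by (simp add: algebra_simps power2_eq_square)
  then have "z' * B + \<i> * g l = 0"
    using quasi_eigenvalue_end(1)[OF b(1) l f z] z' by simp
  then have "\<i> * (z' * B + \<i> * g l) = 0"
    by simp
  then have "g l = \<i> * z' * B"
    by (simp add: algebra_simps)
  then show ?thesis
    using quasi_eigenvalue_iff[OF b(2) l g] by (simp add: B_def)
qed

text \<open>Off the imaginary axis, Lagrange's identity for \<open>f\<close> and its conjugate,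
  divided by \<open>cnj z + z\<close>, gives \<open>(norm (f l))\<^sup>2 = - 2 * Im z * W\<close>
  with \<open>W \<ge> 0\<close>. On the axis this factor is 0, and positivity takes over: for
  \<open>z = \<i> * c\<close> with \<open>c \<ge> 0\<close> the real part of \<open>f\<close> is at
  least 1, but the boundary condition makes it nonpositive at \<open>l\<close>.\<close>

lemma quasi_eigenvalue_Im:
  assumes b: "b \<in> densities l m" and l: "0 < l" and z: "z \<in> quasi_eigenvalues l (string_of l b)"
  shows "Im z < 0"
proof (rule ccontr)
  assume "\<not> ?thesis"
  then have Imz: "Im z \<ge> 0" by simp
  note D = densitiesD[OF b]
  obtain f where f: "volterra l b (z\<^sup>2) f"
    using volterra_exists[OF b l] by blast
  note fc = volterra_continuous[OF f]
  define A where "A = (LINT s|lborel. b s *\<^sub>R f s)"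
  have fl: "f l = \<i> * z * A"
    using z quasi_eigenvalue_iff[OF b l f] by (simp add: A_def)
  show False
  proof (cases "Re z = 0")
    case False
    define W where "W = (LINT s|lborel. b s * (norm (f s))\<^sup>2)"
    have W: "0 \<le> W"
      unfolding W_def using D(3) by (intro Bochner_Integration.integral_nonneg) auto
    have cA: "(LINT s|lborel. b s *\<^sub>R cnj (f s)) = cnj A"
      unfolding A_def by (subst Bochner_Integration.integral_cnj[symmetric])
        (simp del: Bochner_Integration.integral_cnj)
    have "(LINT s|lborel. b s *\<^sub>R (f s * cnj (f s))) = (LINT s|lborel. of_real (b s * (norm (f s))\<^sup>2))"
      by (intro Bochner_Integration.integral_cong refl)
        (simp only: complex_norm_square[symmetric] of_real_mult scaleR_conv_of_real)
    then have cW: "(LINT s|lborel. b s *\<^sub>R (f s * cnj (f s))) = of_real W"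
      unfolding W_def by (simp only: integral_complex_of_real)
    have "volterra l b ((cnj z)\<^sup>2) (\<lambda>x. cnj (f x))"
      using volterra_cnj[OF f] by simp
    from lagrange_identity[OF b b l f this]
    have "f l * ((cnj z)\<^sup>2 * cnj A) - cnj (f l) * (z\<^sup>2 * A) = ((cnj z)\<^sup>2 - z\<^sup>2) * of_real W"
      unfolding cA cW by (simp add: A_def left_diff_distrib)
    moreover have "(cnj z)\<^sup>2 * cnj A = \<i> * cnj z * cnj (f l)" "z\<^sup>2 * A = - \<i> * z * f l"
      unfolding fl by (simp_all add: power2_eq_square algebra_simps)
    ultimately have "f l * (\<i> * cnj z * cnj (f l)) - cnj (f l) * (- \<i> * z * f l) = ((cnj z)\<^sup>2 - z\<^sup>2) * of_real W"
      by (simp only:)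
    then have "\<i> * (cnj z + z) * (f l * cnj (f l)) = ((cnj z)\<^sup>2 - z\<^sup>2) * of_real W"
      by (simp add: algebra_simps)
    also have "(cnj z)\<^sup>2 - z\<^sup>2 = (cnj z + z) * (cnj z - z)"
      by (simp add: power2_eq_square algebra_simps)
    finally have "(cnj z + z) * (\<i> * (f l * cnj (f l))) = (cnj z + z) * ((cnj z - z) * of_real W)"
      by (simp add: mult_ac)
    moreover have "cnj z + z \<noteq> 0"
      using False by (simp add: complex_eq_iff)
    ultimately have "\<i> * (f l * cnj (f l)) = (cnj z - z) * of_real W"
      by (simp only: mult_cancel_left simp_thms)
    then have "Im (\<i> * (f l * cnj (f l))) = Im ((cnj z - z) * of_real W)"
      by (simp only:)
    then have "(norm (f l))\<^sup>2 = - 2 * Im z * W"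
      unfolding cmod_power2 by (simp add: power2_eq_square)
    also have "\<dots> \<le> 0"
      using Imz W by simp
    finally show False
      using quasi_eigenvalue_end(1)[OF b l f z] by simp
  next
    case True
    define c where "c = Im z"
    have z: "z = \<i> * of_real c"
      using True by (simp add: complex_eq_iff c_def)
    have f': "volterra l b (- of_real (c\<^sup>2)) f"
      using f by (simp add: z power_mult_distrib)
    have ge: "1 \<le> Re (f x)" if "x \<in> {0..l}" for x
      using volterra_ge_1[OF b l _ f' that] by simp
    have "0 \<le> b s * Re (f s)" for s
      using ge[of s] D(3,4)[of s] by (cases "s \<in> {0..l}") auto
    then have "0 \<le> (LINT s|lborel. Re (b s *\<^sub>R f s))"
      by (intro Bochner_Integration.integral_nonneg) simp
    also have "\<dots> = Re A"
      unfolding A_def by (intro integral_Re densities_integrable[OF b] fc)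
    finally have "Re (f l) \<le> 0"
      using Imz unfolding fl z by (simp add: c_def)
    with ge[of l] l show False by simp
  qed
qed

section \<open>First-order variations\<close>

text \<open>The mass on \<open>I\<close> is removed and the same amount is spread uniformly over a
  short interval next to \<open>y\<close>. Putting it at \<open>y\<close> itself would gain the
  integral in the last hypothesis but create an atom; half of that gain survives the
  spreading.\<close>

lemma transfer_mass:
  fixes h :: "real \<Rightarrow> real"
  assumes b: "b \<in> densities l m" and l: "0 < l" and h: "continuous_on UNIV h"
    and I: "I \<in> sets borel" and y: "y \<in> {0..l}"
    and mass: "0 < (LINT s|lborel. b s * indicator I s)"
    and gain: "0 < (LINT s|lborel. b s * (indicator I s * (h y - h s)))"
  shows "\<exists>b'\<in>densities l m. 0 < (LINT s|lborel. b' s * h s) - (LINT s|lborel. b s * h s)"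
proof -
  note D = densitiesD[OF b]
  define \<mu> where "\<mu> = (LINT s|lborel. b s * indicator I s)"
  define \<psi> where "\<psi> = (LINT s|lborel. b s * (indicator I s * (h y - h s)))"
  \<comment> \<open>\<open>\<psi> / \<mu>\<close> is the mean gain per unit mass at
    \<open>y\<close>; the level \<open>\<theta>\<close> gives up half of it, which by continuity
    leaves room for an interval around \<open>y\<close>.\<close>
  define \<theta> where "\<theta> = h y - \<psi> / (2 * \<mu>)"
  have pos: "0 < \<mu>" "0 < \<psi>"
    using mass gain by (auto simp: \<mu>_def \<psi>_def)
  have "isCont h y"
    using h by (simp add: continuous_on_eq_continuous_at)
  then obtain d where d: "d > 0" "\<And>s. \<bar>s - y\<bar> < d \<Longrightarrow> \<bar>h s - h y\<bar> < \<psi> / (2 * \<mu>)"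
    using pos unfolding continuous_at_eps_delta dist_real_def
    by (metis divide_pos_pos mult_pos_pos zero_less_numeral)
  \<comment> \<open>\<open>y\<close> may be an end of \<open>[0, l]\<close>, so the interval can be
    one-sided.\<close>
  define p r where "p = max 0 (y - d / 2)" and "r = min l (y + d / 2)"
  have pr: "p < r" "0 \<le> p" "r \<le> l"
    using y l d(1) by (auto simp: p_def r_def)
  have J: "\<theta> \<le> h s" if "s \<in> {p..r}" for s
  proof -
    have "\<bar>s - y\<bar> < d"
      using that d(1) by (auto simp: p_def r_def)
    from d(2)[OF this] show ?thesis
      by (simp add: \<theta>_def)
  qed
  have restrict_I: "integrable lborel (\<lambda>s. indicator I s * (b s * u s))" if "continuous_on UNIV u" for u :: "real \<Rightarrow> real"
    using integrable_mult_indicator[of I lborel "\<lambda>s. b s * u s"] densities_integrable[OF b that] I by simp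
  have int_I: "integrable lborel (\<lambda>s. b s * indicator I s)"
    using restrict_I[of "\<lambda>_. 1"] by (simp add: mult.commute)
  have int_Ih: "integrable lborel (\<lambda>s. b s * (indicator I s * (h y - h s)))"
    using restrict_I[of "\<lambda>s. h y - h s"] h by (simp add: mult_ac continuous_intros)
  have int_J: "integrable lborel (\<lambda>s. indicator {p..r} s * u s)" if "continuous_on UNIV u" for u :: "real \<Rightarrow> real"
    using borel_integrable_atLeastAtMost'[of p r u] continuous_on_subset[OF that, of "{p..r}"]
    by (simp add: set_integrable_def)
  define c where "c = \<mu> / (r - p)"
  have c: "0 \<le> c"
    using pos pr by (simp add: c_def)
  define b' where "b' s = b s - b s * indicator I s + c * indicator {p..r} s" for s
  have int_b': "integrable lborel b'"
    unfolding b'_def using D(1) int_I int_J[of "\<lambda>_. c"] by (auto simp: mult.commute)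
  have mass_b': "(LINT s|lborel. b' s) = (LINT s|lborel. b s)"
  proof -
    have "(LINT s|lborel. b' s) = (LINT s|lborel. b s) - \<mu> + c * (LINT s|lborel. indicator {p..r} s)"
      unfolding b'_def \<mu>_def using D(1) int_I int_J[of "\<lambda>_. c"] by (simp add: mult.commute)
    then show ?thesis
      using pr by (simp add: c_def)
  qed
  have b': "b' \<in> densities l m"
    unfolding densities_def
  proof (intro CollectI conjI allI impI)
    show "0 \<le> b' s" for s
      using D(3)[of s] c by (auto simp: b'_def indicator_def)
    show "b' s = 0" if "s \<notin> {0..l}" for s
      using that D(4)[OF that] pr by (auto simp: b'_def indicator_def)
  qed (use int_b' mass_b' D(5) in auto)
  have i: "integrable lborel (\<lambda>s. b' s * h s)" "integrable lborel (\<lambda>s. b s * h s)"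
    using densities_integrable[OF b' h] densities_integrable[OF b h] by simp_all
  have "\<psi> / 2 = \<psi> - \<psi> / (2 * \<mu>) * \<mu>"
    using pos by simp
  also have "\<dots> = (LINT s|lborel. b s * (indicator I s * (h y - h s)) - \<psi> / (2 * \<mu>) * (b s * indicator I s))"
    using int_I int_Ih by (simp add: \<psi>_def[symmetric] \<mu>_def[symmetric])
  also have "\<dots> \<le> (LINT s|lborel. b' s * h s - b s * h s - \<theta> * (b' s - b s))"
  proof (rule integral_mono)
    show "integrable lborel (\<lambda>s. b s * (indicator I s * (h y - h s)) - \<psi> / (2 * \<mu>) * (b s * indicator I s))"
      using int_I int_Ih by (intro Bochner_Integration.integrable_diff integrable_mult_right)
    show "integrable lborel (\<lambda>s. b' s * h s - b s * h s - \<theta> * (b' s - b s))"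
      using i int_b' D(1) by (intro Bochner_Integration.integrable_diff integrable_mult_right)
    fix s
    have "b' s * h s - b s * h s - \<theta> * (b' s - b s) =
       b s * indicator I s * (\<theta> - h s) + c * (indicator {p..r} s * (h s - \<theta>))"
      by (simp add: b'_def algebra_simps)
    moreover have "0 \<le> c * (indicator {p..r} s * (h s - \<theta>))"
      using c J[of s] by (auto simp: indicator_def)
    moreover have "b s * indicator I s * (\<theta> - h s) =
       b s * (indicator I s * (h y - h s)) - \<psi> / (2 * \<mu>) * (b s * indicator I s)"
      by (simp add: \<theta>_def algebra_simps)
    ultimately show "b s * (indicator I s * (h y - h s)) - \<psi> / (2 * \<mu>) * (b s * indicator I s) \<le>
        b' s * h s - b s * h s - \<theta> * (b' s - b s)"
      by linarith
  qed
  also have "\<dots> = (LINT s|lborel. b' s * h s) - (LINT s|lborel. b s * h s)"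
    using i int_b' D(1) mass_b' by simp
  finally show ?thesis
    using b' pos by (intro bexI[of _ b']) auto
qed

text \<open>The second antiderivative \<open>N\<close> of \<open>b\<close> is continuous, so its
  zero set in the interval is closed; the largest zero is the left end of the support. It is below
  \<open>l\<close> because \<open>N l = 0\<close> would make \<open>b\<close> vanish almost
  everywhere.\<close>

lemma support_start:
  assumes b: "b \<in> densities l m" and l: "0 < l" and mass: "0 < (LINT s|lborel. b s)"
  obtains x0 where "0 \<le> x0" "x0 < l" "(LINT s|lborel. b s * max 0 (x0 - s)) = 0"
    "\<And>y. x0 < y \<Longrightarrow> y \<le> l \<Longrightarrow> 0 < (LINT s|lborel. b s * max 0 (y - s))"
proof -
  note D = densitiesD[OF b]
  define N where "N x = (LINT s|lborel. b s * max 0 (x - s))" for x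
  have "continuous_on UNIV (\<lambda>x. LINT s|lborel. b s *\<^sub>R (\<lambda>(x, s). max 0 (x - s)) (x, s))"
    using D(1,4) by (intro density_integral_continuous) (auto simp: case_prod_unfold intro!: continuous_intros)
  then have N: "continuous_on UNIV N"
    by (simp add: N_def[abs_def])
  have N0: "0 \<le> N x" for x
    unfolding N_def using D(3) by (intro Bochner_Integration.integral_nonneg) auto
  have int: "integrable lborel (\<lambda>s. b s * max 0 (x - s))" for x
    using densities_integrable[OF b, of "\<lambda>s. max 0 (x - s)"] by (simp add: continuous_intros)
  have "N l \<noteq> 0"
  proof
    assume "N l = 0"
    then have "AE s in lborel. b s * max 0 (l - s) = 0"
      using integral_nonneg_eq_0_iff_AE[OF int[of l]] D(3) unfolding N_def by auto
    then have "AE s in lborel. b s = 0"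
      using AE_lborel_singleton[of l]
    proof eventually_elim
      case (elim s)
      then show ?case using D(4)[of s] by (cases "s \<le> l") auto
    qed
    then have "(LINT s|lborel. b s) = 0"
      by (rule integral_eq_zero_AE)
    with mass show False by simp
  qed
  define Z where "Z = {0..l} \<inter> N -` {0}"
  have "closed Z"
    unfolding Z_def using N by (intro closed_Int closed_atLeastAtMost closed_vimage) auto
  moreover have "N 0 = 0"
  proof -
    have "b s * max 0 (0 - s) = 0" for s
      using D(4)[of s] by (cases "s \<in> {0..l}") auto
    then show ?thesis unfolding N_def by (simp only: integral_zero)
  qed
  then have "0 \<in> Z"
    using l by (simp add: Z_def)
  moreover have bdd: "bdd_above Z"
    by (rule bdd_above_mono[of "{0..l}"]) (auto simp: Z_def)
  ultimately have Z: "Sup Z \<in> Z"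
    using closed_contains_Sup by blast
  show ?thesis
  proof (rule that)
    show "0 \<le> Sup Z" "Sup Z < l" "(LINT s|lborel. b s * max 0 (Sup Z - s)) = 0"
      using Z \<open>N l \<noteq> 0\<close> by (auto simp: Z_def N_def less_le)
    fix y assume y: "Sup Z < y" "y \<le> l"
    then have "y \<notin> Z"
      using cSup_upper[OF _ bdd, of y] by auto
    then show "0 < (LINT s|lborel. b s * max 0 (y - s))"
      using y N0[of y] Z by (auto simp: Z_def N_def less_le)
  qed
qed

text \<open>A vanishing integral would force \<open>b\<close> to be 0 almost everywhere on
  \<open>{x0<..<y}\<close>, contradicting the choice of \<open>y\<close> to the right of the start
  of the support.\<close>

lemma support_integral_pos:
  fixes w :: "real \<Rightarrow> real"
  assumes b: "b \<in> densities l m"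
    and x0: "(LINT s|lborel. b s * max 0 (x0 - s)) = 0" and y: "0 < (LINT s|lborel. b s * max 0 (y - s))"
    and int: "integrable lborel (\<lambda>s. b s * w s)"
    and w: "\<And>s. x0 < s \<Longrightarrow> s < y \<Longrightarrow> 0 < w s" "\<And>s. y \<le> s \<Longrightarrow> 0 \<le> w s"
  shows "0 < (LINT s|lborel. b s * w s)"
proof -
  note D = densitiesD[OF b]
  have i: "integrable lborel (\<lambda>s. b s * max 0 (x - s))" for x
    using densities_integrable[OF b, of "\<lambda>s. max 0 (x - s)"] by (simp add: continuous_intros)
  have "AE s in lborel. b s * max 0 (x0 - s) = 0"
    using integral_nonneg_eq_0_iff_AE[OF i[of x0]] D(3) x0 by auto
  \<comment> \<open>The point \<open>x0\<close>, where \<open>w\<close> has no prescribed sign, is a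
    null set: this is where atoms are excluded.\<close>
  then have start: "AE s in lborel. x0 < s \<or> b s = 0"
    using AE_lborel_singleton[of x0] by eventually_elim auto
  then have nonneg: "AE s in lborel. 0 \<le> b s * w s"
  proof eventually_elim
    case (elim s)
    then show ?case
      using D(3)[of s] w[of s] by (cases "s < y") (auto simp: less_imp_le)
  qed
  have "(LINT s|lborel. b s * w s) \<noteq> 0"
  proof
    assume "(LINT s|lborel. b s * w s) = 0"
    then have "AE s in lborel. b s * w s = 0"
      using integral_nonneg_eq_0_iff_AE[OF int nonneg] by simp
    with start have "AE s in lborel. b s * max 0 (y - s) = 0"
    proof eventually_elim
      case (elim s)
      then show ?case
        using w(1)[of s] by (cases "s < y") auto
    qed
    then have "(LINT s|lborel. b s * max 0 (y - s)) = 0"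
      by (rule integral_eq_zero_AE)
    with y show False by simp
  qed
  moreover have "0 \<le> (LINT s|lborel. b s * w s)"
    by (rule integral_nonneg_AE[OF nonneg])
  ultimately show ?thesis by simp
qed

text \<open>To the right of the support's left end \<open>x0\<close> the function \<open>Re (\<eta> * (f x)\<^sup>2)\<close> has derivative
  \<open>- 2 * (LINT s:{..x}|lborel. b s * Re (\<eta> * q * (f s * f x)))\<close>. Since \<open>f x0 = 1\<close>, the sign is that of
  \<open>Re (\<eta> * q)\<close>; if this vanishes, the sign of \<open>Im (f s * f x)\<close> decides, because \<open>f\<close> leaves \<open>1\<close>
  in the direction \<open>- q\<close>.\<close>

lemma kernel_sign:
  assumes b: "b \<in> densities l m" and f: "volterra l b q f"
    and x0: "0 \<le> x0" "x0 < l" "(LINT s|lborel. b s * max 0 (x0 - s)) = 0"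
      "\<And>y. x0 < y \<Longrightarrow> y \<le> l \<Longrightarrow> 0 < (LINT s|lborel. b s * max 0 (y - s))"
    and f1: "f x0 = 1"
    and nz: "q \<noteq> 0" "\<eta> \<noteq> 0" "Im q \<noteq> 0 \<or> Re (\<eta> * q) \<noteq> 0"
  obtains e \<sigma> where "x0 < e" "e \<le> l"
    "\<And>s t. x0 < s \<Longrightarrow> s \<le> e \<Longrightarrow> x0 \<le> t \<Longrightarrow> t \<le> e \<Longrightarrow> (0::real) < \<sigma> * Re (\<eta> * q * (f s * f t))"
proof -
  note fc = volterra_continuous[OF f]
  have near: "\<exists>e>x0. e \<le> l \<and> (\<forall>s\<in>{x0..e}. P s)" if op: "open {s. P s}" "P x0" for P
  proof -
    obtain d where d: "d > 0" "\<And>s. dist s x0 < d \<Longrightarrow> P s"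
      using op unfolding open_dist by (metis mem_Collect_eq)
    then show ?thesis
      using x0(2) by (intro exI[of _ "min l (x0 + d / 2)"]) (auto simp: dist_real_def)
  qed
  show ?thesis
  proof (cases "Re (\<eta> * q) = 0")
    case False
    \<comment> \<open>With this sign \<open>G\<close> equals
      \<open>\<bar>Re (\<eta> * q)\<bar>\<close> at \<open>(x0, x0)\<close>; continuity extends
      positivity to a small square.\<close>
    define \<sigma> where "\<sigma> = sgn (Re (\<eta> * q))"
    define G where "G p = \<sigma> * Re (\<eta> * q * (f (fst p) * f (snd p)))" for p
    have "open {p. 0 < G p}"
      unfolding G_def by (intro open_Collect_less continuous_intros continuous_on_compose2[OF fc]) auto
    moreover have "0 < G (x0, x0)"
      using False by (simp add: G_def f1 \<sigma>_def sgn_if)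
    ultimately obtain A B where AB: "open A" "open B" "x0 \<in> A" "x0 \<in> B" "A \<times> B \<subseteq> {p. 0 < G p}"
      using open_prod_elim[of "{p. 0 < G p}" "(x0, x0)"] by (metis mem_Collect_eq mem_Times_iff fst_conv snd_conv)
    obtain e where "e > x0" "e \<le> l" "\<forall>s\<in>{x0..e}. s \<in> A \<and> s \<in> B"
      using near[of "\<lambda>s. s \<in> A \<and> s \<in> B"] AB by (auto simp: Collect_conj_eq)
    then show ?thesis
      using AB(5) by (intro that[of e \<sigma>]) (auto simp: G_def subset_eq)
  next
    case True
    define \<kappa> where "\<kappa> = Im (\<eta> * q)"
    have \<eta>q: "\<eta> * q = \<i> * of_real \<kappa>"
      using True by (simp add: complex_eq_iff \<kappa>_def)
    then have \<kappa>: "\<kappa> \<noteq> 0"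
      using nz(1,2) by auto
    define \<tau> where "\<tau> = sgn (Im q)"
    have \<tau>: "\<tau> = 1 \<or> \<tau> = -1" "0 < \<tau> * Im q"
      using nz(3) True by (auto simp: \<tau>_def sgn_if)
    \<comment> \<open>Near \<open>x0\<close> the solution is close to 1 and \<open>q * f s\<close>
      to \<open>q\<close>. The equation then shows that \<open>Im f\<close> has the sign opposite to
      \<open>\<tau>\<close>.\<close>
    have "open {s. 0 < \<tau> * Im (q * f s) \<and> 0 < Re (f s)}"
      by (intro open_Collect_conj open_Collect_less continuous_intros fc)
    then obtain e where e: "x0 < e" "e \<le> l" "\<And>s. s \<in> {x0..e} \<Longrightarrow> 0 < \<tau> * Im (q * f s) \<and> 0 < Re (f s)"
      using near[of "\<lambda>s. 0 < \<tau> * Im (q * f s) \<and> 0 < Re (f s)"] \<tau>(2) by (auto simp: f1)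
    have Im_f: "\<tau> * Im (f y) < 0" if y: "x0 < y" "y \<le> e" for y
    proof -
      have i: "integrable lborel (\<lambda>s. b s *\<^sub>R (max 0 (y - s) *\<^sub>R f s))"
        by (intro densities_integrable[OF b] continuous_intros fc)
      have eq: "\<tau> * Im (q * (b s *\<^sub>R (max 0 (y - s) *\<^sub>R f s))) = b s * (max 0 (y - s) * (\<tau> * Im (q * f s)))" for s
        by (simp add: algebra_simps)
      have i': "integrable lborel (\<lambda>s. \<tau> * Im (q * (b s *\<^sub>R (max 0 (y - s) *\<^sub>R f s))))"
        by (rule integrable_mult_right[OF integrable_Im[OF integrable_mult_right[OF i]]])
      have "0 < (LINT s|lborel. b s * (max 0 (y - s) * (\<tau> * Im (q * f s))))"
      proof (rule support_integral_pos[OF b x0(3) x0(4)])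
        show "integrable lborel (\<lambda>s. b s * (max 0 (y - s) * (\<tau> * Im (q * f s))))"
          using i' unfolding eq .
        show "0 < max 0 (y - s) * (\<tau> * Im (q * f s))" if "x0 < s" "s < y" for s
        proof (rule mult_pos_pos)
          show "0 < \<tau> * Im (q * f s)"
            using e(3)[of s] that y by auto
        qed (use that in simp)
      qed (use y e in auto)
      also have "\<dots> = (LINT s|lborel. \<tau> * Im (q * (b s *\<^sub>R (max 0 (y - s) *\<^sub>R f s))))"
        unfolding eq ..
      also have "\<dots> = \<tau> * Im (q * (LINT s|lborel. b s *\<^sub>R (max 0 (y - s) *\<^sub>R f s)))"
        using integral_Im[OF integrable_mult_right[OF i, of q]]
        by (simp only: integral_mult_right_zero)
      also have "q * (LINT s|lborel. b s *\<^sub>R (max 0 (y - s) *\<^sub>R f s)) = 1 - f y"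
        using volterra_eq[OF f, of y] y e x0(1) by (simp add: algebra_simps)
      finally show ?thesis by simp
    qed
    show ?thesis
    proof (rule that[OF e(1,2)])
      \<comment> \<open>In \<open>Im (f s * f t)\<close> the term with \<open>Im (f s)\<close> is
        strictly of one sign since \<open>s\<close> exceeds \<open>x0\<close>; the term with
        \<open>Im (f t)\<close> is so only weakly, as it is 0 at \<open>t = x0\<close>.\<close>
      fix s t assume st: "x0 < s" "s \<le> e" "x0 \<le> t" "t \<le> e"
      have t: "\<tau> * Im (f t) \<le> 0"
        using Im_f[of t] st by (cases "t = x0") (auto simp: f1)
      have "(\<tau> * Im (f s)) * Re (f t) < 0"
        using Im_f[of s] e(3)[of t] st by (simp add: mult_neg_pos)
      moreover have "Re (f s) * (\<tau> * Im (f t)) \<le> 0"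
        using t e(3)[of s] st by (simp add: mult_nonneg_nonpos)
      ultimately have "\<tau> * Im (f s * f t) < 0"
        by (simp add: algebra_simps)
      \<comment> \<open>As \<open>Re (\<i> * \<kappa> * u) = - \<kappa> * Im u\<close>, the required
        sign factor is \<open>\<tau> * \<kappa>\<close>.\<close>
      then have "0 < \<kappa>\<^sup>2 * - (\<tau> * Im (f s * f t))"
        using \<kappa> by (intro mult_pos_pos) auto
      also have "\<dots> = (\<tau> * \<kappa>) * Re (\<eta> * q * (f s * f t))"
        unfolding \<eta>q by (simp add: algebra_simps power2_eq_square)
      finally show "0 < (\<tau> * \<kappa>) * Re (\<eta> * q * (f s * f t))" .
    qed
  qed
qed

text \<open>Mass close to the start of the support is moved to the better end of an interval on
  which \<open>Re (\<eta> * (f x)\<^sup>2)\<close> is strictly monotone. The last hypothesis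
  excludes real \<open>q\<close> with purely imaginary \<open>\<eta>\<close>: there \<open>f\<close>
  is real and the functional is identically 0.\<close>

lemma improving_density:
  assumes b: "b \<in> densities l m" and l: "0 < l" and f: "volterra l b q f"
    and mass: "0 < (LINT s|lborel. b s)"
    and nz: "q \<noteq> 0" "\<eta> \<noteq> 0" "Im q \<noteq> 0 \<or> Re (\<eta> * q) \<noteq> 0"
  shows "\<exists>b'\<in>densities l m.
    0 < Re (\<eta> * ((LINT s|lborel. b' s *\<^sub>R (f s * f s)) - (LINT s|lborel. b s *\<^sub>R (f s * f s))))"
proof -
  note D = densitiesD[OF b] and fc = volterra_continuous[OF f]
  obtain x0 where x0: "0 \<le> x0" "x0 < l" "(LINT s|lborel. b s * max 0 (x0 - s)) = 0"
      "\<And>y. x0 < y \<Longrightarrow> y \<le> l \<Longrightarrow> 0 < (LINT s|lborel. b s * max 0 (y - s))"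
    using support_start[OF b l mass] by blast
  have "f x0 = 1"
  proof -
    have "AE s in lborel. b s * max 0 (x0 - s) = 0"
      using integral_nonneg_eq_0_iff_AE[of lborel "\<lambda>s. b s * max 0 (x0 - s)"] D(3) x0(3)
        densities_integrable[OF b, of "\<lambda>s. max 0 (x0 - s)"] by (auto simp: continuous_intros)
    then have "AE s in lborel. b s *\<^sub>R (max 0 (x0 - s) *\<^sub>R f s) = 0"
      by eventually_elim auto
    then have "(LINT s|lborel. b s *\<^sub>R (max 0 (x0 - s) *\<^sub>R f s)) = 0"
      by (rule integral_eq_zero_AE)
    then show ?thesis
      using volterra_eq[OF f, of x0] x0 by simp
  qed
  from kernel_sign[OF b f x0 this nz] obtain e \<sigma> where e: "x0 < e" "e \<le> l"
    and sign: "\<And>s t. x0 < s \<Longrightarrow> s \<le> e \<Longrightarrow> x0 \<le> t \<Longrightarrow> t \<le> e \<Longrightarrow> (0::real) < \<sigma> * Re (\<eta> * q * (f s * f t))"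
    by blast
  define h where "h x = Re (\<eta> * (f x * f x))" for x
  have hc: "continuous_on UNIV h"
    unfolding h_def by (intro continuous_intros fc)
  have mono: "\<sigma> * h y < \<sigma> * h x" if xy: "x0 \<le> x" "x < y" "y \<le> e" for x y
  proof -
    \<comment> \<open>A difference in place of the derivative: \<open>h x - h y\<close> is
      \<open>Re (\<eta> * (f x + f y) * (f x - f y))\<close>, and by the equation
      \<open>f x - f y\<close> is \<open>q\<close> times the integral of \<open>b k f\<close>. So
      \<open>b w\<close> integrates to \<open>\<sigma> * (h x - h y)\<close>.\<close>
    define k where "k s = max 0 (y - s) - max 0 (x - s)" for s
    have kc: "continuous_on UNIV k"
      unfolding k_def by (intro continuous_intros)
    define w where "w s = k s * (\<sigma> * Re (\<eta> * q * (f s * f x)) + \<sigma> * Re (\<eta> * q * (f s * f y)))" for s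
    have wc: "continuous_on UNIV w"
      unfolding w_def by (intro continuous_intros kc fc)
    have "0 < (LINT s|lborel. b s * w s)"
    proof (rule support_integral_pos[OF b x0(3) x0(4)])
      show "integrable lborel (\<lambda>s. b s * w s)"
        using densities_integrable[OF b wc] by simp
      show "0 < w s" if "x0 < s" "s < y" for s
      proof -
        have "0 < k s"
          using that xy by (auto simp: k_def)
        moreover have "0 < \<sigma> * Re (\<eta> * q * (f s * f x))" "0 < \<sigma> * Re (\<eta> * q * (f s * f y))"
          using that xy by (auto intro!: sign simp del: times_complex.sel)
        ultimately show ?thesis
          unfolding w_def by (rule mult_pos_pos[OF _ add_pos_pos])
      qed
      show "0 \<le> w s" if "y \<le> s" for s
        using that xy by (simp add: w_def k_def)
    qed (use xy e in auto)
    also have "(LINT s|lborel. b s * w s) = (LINT s|lborel. \<sigma> * Re (\<eta> * q * (f x + f y) * (b s *\<^sub>R (k s *\<^sub>R f s))))"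
      by (intro Bochner_Integration.integral_cong refl) (simp add: w_def algebra_simps)
    also have "\<dots> = \<sigma> * Re (\<eta> * q * (f x + f y) * (LINT s|lborel. b s *\<^sub>R (k s *\<^sub>R f s)))"
      using integral_Re[OF integrable_mult_right[OF densities_integrable[OF b continuous_on_scaleR[OF kc fc]]]]
      by (simp only: integral_mult_right_zero)
    also have "(LINT s|lborel. b s *\<^sub>R (k s *\<^sub>R f s)) =
        (LINT s|lborel. b s *\<^sub>R (max 0 (y - s) *\<^sub>R f s) - b s *\<^sub>R (max 0 (x - s) *\<^sub>R f s))"
      by (simp add: k_def scaleR_diff_left scaleR_diff_right del: scaleR_scaleR)
    also have "\<dots> = (LINT s|lborel. b s *\<^sub>R (max 0 (y - s) *\<^sub>R f s)) - (LINT s|lborel. b s *\<^sub>R (max 0 (x - s) *\<^sub>R f s))"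
      by (intro Bochner_Integration.integral_diff densities_integrable[OF b] continuous_intros fc)
    finally have "0 < \<sigma> * Re (\<eta> * (f x + f y) * (q * ((LINT s|lborel. b s *\<^sub>R (max 0 (y - s) *\<^sub>R f s)) -
        (LINT s|lborel. b s *\<^sub>R (max 0 (x - s) *\<^sub>R f s)))))"
      by (simp only: mult_ac)
    also have "q * ((LINT s|lborel. b s *\<^sub>R (max 0 (y - s) *\<^sub>R f s)) -
        (LINT s|lborel. b s *\<^sub>R (max 0 (x - s) *\<^sub>R f s))) = f x - f y"
      using volterra_eq[OF f, of x] volterra_eq[OF f, of y] xy x0(1) e by (simp add: right_diff_distrib)
    also have "\<eta> * (f x + f y) * (f x - f y) = \<eta> * (f x * f x) - \<eta> * (f y * f y)"
      by (simp add: algebra_simps)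
    finally show ?thesis
      by (simp add: h_def right_diff_distrib)
  qed
  define I where "I = {x0<..<e}"
  \<comment> \<open>The left end is best for a decreasing \<open>h\<close>, the right end for an
    increasing one; \<open>\<sigma> = 0\<close> is impossible by \<open>sign\<close> at
    \<open>(e, e)\<close>.\<close>
  obtain y where y: "y \<in> {0..l}" "\<And>s. s \<in> I \<Longrightarrow> h s < h y"
  proof (cases "0 < \<sigma>")
    case True
    show ?thesis
      using mono[of x0] True x0 e by (intro that[of x0]) (auto simp: I_def)
  next
    case False
    then have \<sigma>: "\<sigma> < 0"
      using sign[of e e] e by (cases "\<sigma> = 0") auto
    show ?thesis
      using mono[of _ e] \<sigma> x0 e by (intro that[of e]) (auto simp: I_def)
  qed
  have I: "I \<in> sets borel"
    by (simp add: I_def)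
  have "\<exists>b'\<in>densities l m. 0 < (LINT s|lborel. b' s * h s) - (LINT s|lborel. b s * h s)"
  proof (rule transfer_mass[OF b l hc I y(1)])
    have "integrable lborel (\<lambda>s. b s * (indicator I s * u s))" if "continuous_on UNIV u" for u :: "real \<Rightarrow> real"
      using integrable_mult_indicator[of I lborel "\<lambda>s. b s * u s"] densities_integrable[OF b that] I
      by (simp add: mult_ac)
    from this[of "\<lambda>_. 1"] this[of "\<lambda>s. h y - h s"] hc
    have i: "integrable lborel (\<lambda>s. b s * indicator I s)" "integrable lborel (\<lambda>s. b s * (indicator I s * (h y - h s)))"
      by (simp_all add: continuous_intros)
    show "0 < (LINT s|lborel. b s * indicator I s)"
      by (rule support_integral_pos[OF b x0(3) x0(4)[OF e] i(1)]) (auto simp: I_def)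
    show "0 < (LINT s|lborel. b s * (indicator I s * (h y - h s)))"
      by (rule support_integral_pos[OF b x0(3) x0(4)[OF e] i(2)]) (use y(2) in \<open>auto simp: I_def\<close>)
  qed
  moreover have "(LINT s|lborel. c s * h s) = Re (\<eta> * (LINT s|lborel. c s *\<^sub>R (f s * f s)))" if c: "c \<in> densities l m" for c
  proof -
    have "(LINT s|lborel. c s * h s) = (LINT s|lborel. Re (\<eta> * (c s *\<^sub>R (f s * f s))))"
      by (intro Bochner_Integration.integral_cong refl) (simp add: h_def algebra_simps)
    also have "\<dots> = Re (LINT s|lborel. \<eta> * (c s *\<^sub>R (f s * f s)))"
      by (rule integral_Re[OF integrable_mult_right]) (intro densities_integrable[OF c] continuous_intros fc)
    finally show ?thesis by (simp only: integral_mult_right_zero)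
  qed
  ultimately show ?thesis
    using b by (simp add: right_diff_distrib)
qed

section \<open>Quasi-eigenvalues of perturbed densities\<close>

lemma tendsto_lipschitz_at:
  fixes h :: "'a::real_normed_vector \<Rightarrow> 'b::real_normed_vector"
  assumes "\<And>w. w \<in> S \<Longrightarrow> norm (h w - h w0) \<le> C * norm (w - w0)"
  shows "(h \<longlongrightarrow> h w0) (at w0 within S)"
proof (rule LIM_zero_cancel, rule Lim_null_comparison)
  show "\<forall>\<^sub>F w in at w0 within S. norm (h w - h w0) \<le> C * norm (w - w0)"
    using assms by (auto simp: eventually_at_filter intro!: always_eventually)
  have "((\<lambda>w. C * norm (w - w0)) \<longlongrightarrow> C * norm (w0 - w0)) (at w0 within S)"
    by (intro tendsto_intros)
  then show "((\<lambda>w. C * norm (w - w0)) \<longlongrightarrow> 0) (at w0 within S)"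
    by simp
qed

text \<open>For \<open>z\<close> near \<open>\<omega>\<close>, Brouwer's theorem solves the eigenvalue equation for the parameter \<open>w\<close>
  of the density at fixed \<open>z\<close>, rather than for \<open>z\<close> at a fixed density. Only the dependence of the
  equation on \<open>w\<close> is used, so the multiplicity of \<open>\<omega>\<close> plays no role.\<close>

lemma perturbed_eigenvalue:
  fixes B :: "complex \<Rightarrow> real \<Rightarrow> real" and E :: "complex set"
  assumes b: "b \<in> densities l m" and l: "0 < l" and f: "volterra l b (\<omega>\<^sup>2) f"
    and \<omega>: "\<omega> \<in> quasi_eigenvalues l (string_of l b)"
    and E: "E = UNIV \<or> E = \<real> \<and> Re \<omega> = 0"
    and r: "0 < r" and \<Lambda>: "0 \<le> \<Lambda>"
    and B: "\<And>w. w \<in> E \<Longrightarrow> norm w \<le> 1 / 2 \<Longrightarrow> B w \<in> densities l m"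
    and lip: "\<And>w w'. w \<in> E \<Longrightarrow> norm w \<le> 1 / 2 \<Longrightarrow> w' \<in> E \<Longrightarrow> norm w' \<le> 1 / 2 \<Longrightarrow>
      (LINT s|lborel. \<bar>B w s - B w' s\<bar>) \<le> \<Lambda> * norm (w - w')"
    and B0: "B 0 = b"
    and lin: "\<And>w. w \<in> E \<Longrightarrow> norm w \<le> 1 / 2 \<Longrightarrow>
      (LINT s|lborel. B w s *\<^sub>R (f s * f s)) - (LINT s|lborel. b s *\<^sub>R (f s * f s)) = of_real r * w"
  shows "\<exists>\<delta>>0. \<forall>z. norm (z - \<omega>) < \<delta> \<longrightarrow> (E = \<real> \<longrightarrow> Re z = 0) \<longrightarrow> z \<in> Sigma_family l (A1 l m)"
proof -
  note D = densitiesD[OF b] and fc = volterra_continuous[OF f]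
  define S where "S = E \<inter> cball 0 (1 / 2)"
  have S: "w \<in> E" "norm w \<le> 1 / 2" if "w \<in> S" for w
    using that by (auto simp: S_def)
  have E0: "0 \<in> E"
    using E by auto
  then have S0: "0 \<in> S"
    by (simp add: S_def)
  have BS: "B w \<in> densities l m" if "w \<in> S" for w
    using B S that by blast
  define I where "I w h = (LINT s|lborel. B w s *\<^sub>R h s)" for w and h :: "real \<Rightarrow> complex"
  have I_bound: "norm (I w h) \<le> K * m" if w: "w \<in> S" and K: "\<And>s. s \<in> {0..l} \<Longrightarrow> norm (h s) \<le> K" for w h K
  proof -
    note D' = densitiesD[OF BS[OF w]]
    have "norm (I w h) \<le> K * (LINT s|lborel. \<bar>B w s\<bar>)"
      unfolding I_def by (rule density_norm_integral_le[OF D'(1,4) K])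
    also have "(LINT s|lborel. \<bar>B w s\<bar>) = (LINT s|lborel. B w s)"
      using D'(3) by simp
    also have "K * \<dots> \<le> K * m"
      using D'(5) order_trans[OF norm_ge_zero K[of 0]] l by (intro mult_left_mono) auto
    finally show ?thesis .
  qed
  have I_diff: "I w (\<lambda>s. h s - k s) = I w h - I w k" if "w \<in> S" "continuous_on UNIV h" "continuous_on UNIV k" for w h k
    unfolding I_def scaleR_diff_right
    by (intro Bochner_Integration.integral_diff densities_integrable[OF BS] that)
  have I_lip: "norm (I w h - I w' h) \<le> K * (\<Lambda> * norm (w - w'))"
    if w: "w \<in> S" "w' \<in> S" and h: "continuous_on UNIV h" and K: "\<And>s. s \<in> {0..l} \<Longrightarrow> norm (h s) \<le> K" for w w' h K
  proof -
    note D1 = densitiesD[OF BS[OF w(1)]] and D2 = densitiesD[OF BS[OF w(2)]]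
    have "I w h - I w' h = (LINT s|lborel. (B w s - B w' s) *\<^sub>R h s)"
      unfolding I_def scaleR_diff_left
      by (intro Bochner_Integration.integral_diff[symmetric] densities_integrable[OF BS] w h)
    also have "norm \<dots> \<le> K * (LINT s|lborel. \<bar>B w s - B w' s\<bar>)"
      using D1(1,4) D2(1,4) K by (intro density_norm_integral_le) auto
    also have "\<dots> \<le> K * (\<Lambda> * norm (w - w'))"
      using lip[OF S[OF w(1)] S[OF w(2)]] order_trans[OF norm_ge_zero K[of 0]] l by (intro mult_left_mono) auto
    finally show ?thesis .
  qed
  define Q where "Q = (norm \<omega> + 1)\<^sup>2"
  define X where "X = 2 * exp ((2 * Q * m + 1) * l)"
  have X: "0 \<le> X" "0 \<le> Q"
    by (auto simp: X_def Q_def)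
  have dep: "norm (g x - g0 x) \<le> X * (l * K * (Q * \<Lambda> * norm (w - w0) + norm (z\<^sup>2 - z0\<^sup>2) * m))"
    if w: "w \<in> S" "w0 \<in> S" and g0: "volterra l (B w0) (z0\<^sup>2) g0" and g: "volterra l (B w) (z\<^sup>2) g"
      and z: "norm (z\<^sup>2) \<le> Q" and K: "\<And>s. s \<in> {0..l} \<Longrightarrow> norm (g0 s) \<le> K" and x: "x \<in> {0..l}"
    for w w0 g g0 z z0 K x
  proof -
    have K0: "0 \<le> K"
      using order_trans[OF norm_ge_zero K[of 0]] l by simp
    have "norm (g x - g0 x) \<le> 2 * (l * K * (Q * \<Lambda> * norm (w - w0) + norm (z\<^sup>2 - z0\<^sup>2) * m)) * exp ((2 * Q * m + 1) * l)"
    proof (rule volterra_dependence[OF BS[OF w(2)] BS[OF w(1)] l g0 g _ z x])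
      fix x assume x: "x \<in> {0..l}"
      let ?h = "\<lambda>s. max 0 (x - s) *\<^sub>R g0 s"
      have h: "continuous_on UNIV ?h"
        by (intro continuous_intros volterra_continuous[OF g0])
      have hK: "norm (?h s) \<le> l * K" if "s \<in> {0..l}" for s
        using K[OF that] that x K0 by (auto intro!: mult_mono)
      have eq: "z\<^sup>2 * I w ?h - z0\<^sup>2 * I w0 ?h = z\<^sup>2 * (I w ?h - I w0 ?h) + (z\<^sup>2 - z0\<^sup>2) * I w0 ?h"
        by (simp add: algebra_simps)
      have "norm (z\<^sup>2 * I w ?h - z0\<^sup>2 * I w0 ?h) \<le> norm (z\<^sup>2) * norm (I w ?h - I w0 ?h) + norm (z\<^sup>2 - z0\<^sup>2) * norm (I w0 ?h)"
        unfolding eq norm_mult[symmetric] by (rule norm_triangle_ineq)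
      also have "\<dots> \<le> Q * (l * K * (\<Lambda> * norm (w - w0))) + norm (z\<^sup>2 - z0\<^sup>2) * (l * K * m)"
        using z X I_lip[OF w h hK] I_bound[OF w(2) hK] by (intro add_mono mult_mono) auto
      finally show "norm (z\<^sup>2 * (LINT s|lborel. B w s *\<^sub>R ?h s) - z0\<^sup>2 * (LINT s|lborel. B w0 s *\<^sub>R ?h s)) \<le>
         l * K * (Q * \<Lambda> * norm (w - w0) + norm (z\<^sup>2 - z0\<^sup>2) * m)"
        unfolding I_def[symmetric] by (simp only: distrib_left mult_ac)
    qed
    then show ?thesis
      by (simp only: X_def mult_ac)
  qed
  obtain K where K: "\<And>x. x \<in> {0..l} \<Longrightarrow> norm (f x) \<le> K"
    using volterra_bounded[OF f] by blast
  have K0: "0 \<le> K"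
    using order_trans[OF norm_ge_zero K[of 0]] l by simp
  have fS0: "volterra l (B 0) (\<omega>\<^sup>2) f"
    using f by (simp add: B0)
  have \<omega>0: "0 < norm \<omega>"
    using quasi_eigenvalue_end(2)[OF b l f \<omega>] by simp
  \<comment> \<open>\<open>L\<close> bounds \<open>norm (z + \<omega>)\<close>,
    \<open>C0 * (norm w + d)\<close> the distance of \<open>g w\<close> from \<open>f\<close>, and
    \<open>G\<close> bounds \<open>g w\<close>. \<open>A\<close> and \<open>R\<close> are the
    constants of the two error terms \<open>Y\<close> and \<open>Z\<close> below:
    \<open>norm Y / r \<le> A * (norm w + d) * norm w\<close> and
    \<open>norm Z \<le> d * R\<close>.\<close>
  define L where "L = 2 * norm \<omega> + 1"
  define C0 where "C0 = X * (l * K * (Q * \<Lambda> + L * m))"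
  define G where "G = K + 2 * C0"
  define A where "A = K * C0 * \<Lambda> / r"
  define R where "R = L * (K * G * m) + K * G"
  have m0: "0 \<le> m" by (rule D(7))
  have L0: "0 \<le> L"
    by (simp add: L_def)
  have C0: "0 \<le> C0"
    using X L0 K0 l \<Lambda> m0 by (simp add: C0_def)
  have nonneg: "0 \<le> G" "0 \<le> A" "0 \<le> R"
    using C0 K0 \<Lambda> r L0 m0 by (auto simp: G_def A_def R_def)
  define \<rho> where "\<rho> = min (1 / 2) (1 / (4 * (A + 1)))"
  have \<rho>: "0 < \<rho>" "\<rho> \<le> 1 / 2" "A * (2 * \<rho>) \<le> 1 / 2"
  proof -
    show "0 < \<rho>" "\<rho> \<le> 1 / 2"
      using nonneg by (auto simp: \<rho>_def)
    have "A * (2 * \<rho>) \<le> A * (2 * (1 / (4 * (A + 1))))"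
      using nonneg by (intro mult_left_mono) (auto simp: \<rho>_def)
    also have "\<dots> \<le> 1 / 2"
      using nonneg by (simp add: divide_simps)
    finally show "A * (2 * \<rho>) \<le> 1 / 2" .
  qed
  define \<delta> where "\<delta> = min (min \<rho> (norm \<omega> / 2)) (\<rho> * r * (norm \<omega>)\<^sup>2 / (8 * (R + 1)))"
  have \<delta>: "0 < \<delta>" "\<delta> \<le> \<rho>" "\<delta> \<le> norm \<omega> / 2" "\<delta> \<le> \<rho> * r * (norm \<omega>)\<^sup>2 / (8 * (R + 1))"
  proof -
    have "0 < \<rho> * r * (norm \<omega>)\<^sup>2 / (8 * (R + 1))"
      using \<rho> \<omega>0 r nonneg by (intro divide_pos_pos mult_pos_pos) auto
    then show "0 < \<delta>"
      using \<rho> \<omega>0 unfolding \<delta>_def by linarith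
    show "\<delta> \<le> \<rho>" "\<delta> \<le> norm \<omega> / 2" "\<delta> \<le> \<rho> * r * (norm \<omega>)\<^sup>2 / (8 * (R + 1))"
      unfolding \<delta>_def by linarith+
  qed
  have "z \<in> Sigma_family l (A1 l m)" if z: "norm (z - \<omega>) < \<delta>" and zE: "E = \<real> \<longrightarrow> Re z = 0" for z
  proof -
    define d where "d = norm (z - \<omega>)"
    have d: "0 \<le> d" "d \<le> \<rho>" "d \<le> 1 / 2" "d \<le> norm \<omega> / 2" "d \<le> \<rho> * r * (norm \<omega>)\<^sup>2 / (8 * (R + 1))"
      using z \<delta> \<rho> by (auto simp: d_def)
    have nz: "norm z \<le> norm \<omega> + d" "norm \<omega> - d \<le> norm z"
      unfolding d_def using norm_triangle_ineq2[of z \<omega>] norm_triangle_ineq3[of z \<omega>] by linarith+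
    have zQ: "norm (z\<^sup>2) \<le> Q"
      unfolding Q_def norm_power using nz d by (intro power_mono) auto
    have z2: "(norm \<omega>)\<^sup>2 / 4 \<le> norm (z\<^sup>2)"
    proof -
      have "(norm \<omega> / 2)\<^sup>2 \<le> (norm z)\<^sup>2"
        using nz d by (intro power_mono) auto
      then show ?thesis by (simp add: norm_power power_divide)
    qed
    have z0: "z \<noteq> 0"
    proof -
      have "0 < norm z"
        using nz(2) d(4) \<omega>0 by linarith
      then show ?thesis by simp
    qed
    have zL: "norm (z\<^sup>2 - \<omega>\<^sup>2) \<le> d * L"
    proof -
      have "z\<^sup>2 - \<omega>\<^sup>2 = (z - \<omega>) * (z + \<omega>)"
        by (simp add: power2_eq_square algebra_simps)
      moreover have "norm (z + \<omega>) \<le> L"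
        using norm_triangle_ineq[of z \<omega>] nz d by (simp add: L_def)
      ultimately show ?thesis
        using d by (simp add: norm_mult mult_left_mono flip: d_def)
    qed
    define g where "g w = (SOME g. volterra l (B w) (z\<^sup>2) g)" for w
    have g: "volterra l (B w) (z\<^sup>2) (g w)" if "w \<in> S" for w
      unfolding g_def by (rule someI_ex[OF volterra_exists[OF BS[OF that] l]])
    have gc: "continuous_on UNIV (g w)" if "w \<in> S" for w
      by (rule volterra_continuous[OF g[OF that]])
    have gf: "norm (g w s - f s) \<le> C0 * (norm w + d)" if "w \<in> S" "s \<in> {0..l}" for w s
    proof -
      have "norm (g w s - f s) \<le> X * (l * K * (Q * \<Lambda> * norm (w - 0) + norm (z\<^sup>2 - \<omega>\<^sup>2) * m))"
        by (rule dep[OF that(1) S0 fS0 g[OF that(1)] zQ K that(2)])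
      also have "\<dots> \<le> X * (l * K * (Q * \<Lambda> * (norm w + d) + (norm w + d) * L * m))"
        using X K0 l \<Lambda> m0 d L0 order_trans[OF zL mult_right_mono[of d "norm w + d" L]]
        by (intro mult_left_mono add_mono mult_right_mono) auto
      also have "\<dots> = C0 * (norm w + d)"
        by (simp add: C0_def algebra_simps)
      finally show ?thesis .
    qed
    have gG: "norm (g w s) \<le> G" if "w \<in> S" "s \<in> {0..l}" for w s
    proof -
      have "norm (g w s) \<le> norm (f s) + norm (g w s - f s)"
        by (metis add.commute diff_add_cancel norm_triangle_ineq)
      moreover have "C0 * (norm w + d) \<le> C0 * 2"
        using S(2)[OF that(1)] d C0 by (intro mult_left_mono) auto
      ultimately show ?thesis
        using K[OF that(2)] gf[OF that] by (simp add: G_def)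
    qed
    define H where "H w = z\<^sup>2 * I w (\<lambda>s. f s * g w s) - \<omega>\<^sup>2 * I 0 (\<lambda>s. f s * g w s) + \<i> * (z - \<omega>) * f l * g w l" for w
    \<comment> \<open>A simplified Newton step: the linear part of \<open>H\<close> in
      \<open>w\<close> is multiplication by \<open>z\<^sup>2 * r\<close>, so \<open>T\<close>
      retains only the errors, and its fixed points are the zeros of \<open>H\<close>.\<close>
    define T where "T w = w - H w / (z\<^sup>2 * of_real r)" for w
    have H_cont: "(H \<longlongrightarrow> H w0) (at w0 within S)" if w0: "w0 \<in> S" for w0
    proof -
      obtain K' where K': "\<And>s. s \<in> {0..l} \<Longrightarrow> norm (g w0 s) \<le> K'"
        using volterra_bounded[OF g[OF w0]] by blast
      define C where "C = X * (l * K' * (Q * \<Lambda>))"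
      have gg: "norm (g w s - g w0 s) \<le> C * norm (w - w0)" if "w \<in> S" "s \<in> {0..l}" for w s
        using dep[OF that(1) w0 g[OF w0] g[OF that(1)] zQ K' that(2)] by (simp add: C_def algebra_simps)
      have fgg: "norm (f s * (g w s - g w0 s)) \<le> K * (C * norm (w - w0))" if "w \<in> S" "s \<in> {0..l}" for w s
        unfolding norm_mult using K[OF that(2)] gg[OF that] K0 by (intro mult_mono) auto
      have fg0: "norm (f s * g w0 s) \<le> K * K'" if "s \<in> {0..l}" for s
        unfolding norm_mult using K[OF that] K'[OF that] K0 by (intro mult_mono) auto
      have diff: "I v (\<lambda>s. f s * g w s) - I v (\<lambda>s. f s * g w0 s) = I v (\<lambda>s. f s * (g w s - g w0 s))" if "v \<in> S" "w \<in> S" for v w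
        unfolding right_diff_distrib using that w0 by (intro I_diff[symmetric] continuous_intros fc gc)
      have 1: "((\<lambda>w. g w l) \<longlongrightarrow> g w0 l) (at w0 within S)"
        using gg[of _ l] l by (intro tendsto_lipschitz_at[where C = C]) auto
      have 2: "((\<lambda>w. I 0 (\<lambda>s. f s * g w s)) \<longlongrightarrow> I 0 (\<lambda>s. f s * g w0 s)) (at w0 within S)"
      proof (rule tendsto_lipschitz_at)
        fix w assume w: "w \<in> S"
        show "norm (I 0 (\<lambda>s. f s * g w s) - I 0 (\<lambda>s. f s * g w0 s)) \<le> (K * C * m) * norm (w - w0)"
          unfolding diff[OF S0 w] using I_bound[OF S0 fgg[OF w]] by (simp add: mult_ac)
      qed
      have 3: "((\<lambda>w. I w (\<lambda>s. f s * g w s)) \<longlongrightarrow> I w0 (\<lambda>s. f s * g w0 s)) (at w0 within S)"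
      proof (rule tendsto_lipschitz_at)
        fix w assume w: "w \<in> S"
        have eq: "I w (\<lambda>s. f s * g w s) - I w0 (\<lambda>s. f s * g w0 s) =
          I w (\<lambda>s. f s * (g w s - g w0 s)) + (I w (\<lambda>s. f s * g w0 s) - I w0 (\<lambda>s. f s * g w0 s))"
          unfolding diff[OF w w, symmetric] by simp
        have "norm (I w (\<lambda>s. f s * g w s) - I w0 (\<lambda>s. f s * g w0 s)) \<le>
            K * (C * norm (w - w0)) * m + K * K' * (\<Lambda> * norm (w - w0))"
          unfolding eq
        proof (rule order_trans[OF norm_triangle_ineq add_mono])
          show "norm (I w (\<lambda>s. f s * (g w s - g w0 s))) \<le> K * (C * norm (w - w0)) * m"
            by (rule I_bound[OF w fgg[OF w]])
          show "norm (I w (\<lambda>s. f s * g w0 s) - I w0 (\<lambda>s. f s * g w0 s)) \<le> K * K' * (\<Lambda> * norm (w - w0))"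
            by (rule I_lip[OF w w0 _ fg0]) (intro continuous_intros fc gc w0)
        qed
        then show "norm (I w (\<lambda>s. f s * g w s) - I w0 (\<lambda>s. f s * g w0 s)) \<le> (K * C * m + K * K' * \<Lambda>) * norm (w - w0)"
          by (simp add: algebra_simps)
      qed
      show ?thesis
        unfolding H_def by (intro tendsto_intros 1 2 3)
    qed
    have T_bound: "norm (T w) \<le> \<rho>" if w: "w \<in> S" "norm w \<le> \<rho>" for w
    proof -
      \<comment> \<open>\<open>Y\<close> is of second order, being a difference of densities applied
        to a difference of solutions; \<open>Z\<close> is of order \<open>d\<close> and present even
        at \<open>w = 0\<close>.\<close>
      define Y where "Y = I w (\<lambda>s. f s * (g w s - f s)) - I 0 (\<lambda>s. f s * (g w s - f s))"
      define Z where "Z = (z\<^sup>2 - \<omega>\<^sup>2) * I 0 (\<lambda>s. f s * g w s) + \<i> * (z - \<omega>) * f l * g w l"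
      have "I v (\<lambda>s. f s * g w s) = I v (\<lambda>s. f s * f s) + I v (\<lambda>s. f s * (g w s - f s))" if "v \<in> S" for v
      proof -
        have "I v (\<lambda>s. f s * (g w s - f s)) = I v (\<lambda>s. f s * g w s) - I v (\<lambda>s. f s * f s)"
          unfolding right_diff_distrib using that w by (intro I_diff continuous_intros fc gc)
        then show ?thesis by simp
      qed
      from this[OF w(1)] this[OF S0] lin[OF S[OF w(1)]]
      have "I w (\<lambda>s. f s * g w s) - I 0 (\<lambda>s. f s * g w s) = of_real r * w + Y"
        by (simp add: Y_def) (simp add: I_def B0 algebra_simps)
      then have "H w = z\<^sup>2 * of_real r * w + z\<^sup>2 * Y + Z"
        unfolding H_def Z_def by (simp add: algebra_simps)
      then have "T w = - (Y / of_real r) - Z / (z\<^sup>2 * of_real r)"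
        using z0 r by (simp add: T_def field_simps)
      then have "norm (T w) \<le> norm Y / r + norm Z / (norm (z\<^sup>2) * r)"
        using norm_triangle_ineq4[of "- (Y / of_real r)" "Z / (z\<^sup>2 * of_real r)"] r
        by (simp add: norm_divide norm_mult)
      also have "\<dots> \<le> \<rho> / 2 + \<rho> / 2"
      proof (rule add_mono)
        have "norm Y \<le> (K * (C0 * (norm w + d))) * (\<Lambda> * norm (w - 0))"
          unfolding Y_def
        proof (rule I_lip[OF w(1) S0])
          show "continuous_on UNIV (\<lambda>s. f s * (g w s - f s))"
            by (intro continuous_intros fc gc w)
          fix s assume s: "s \<in> {0..l}"
          show "norm (f s * (g w s - f s)) \<le> K * (C0 * (norm w + d))"
            unfolding norm_mult using K[OF s] gf[OF w(1) s] K0 by (intro mult_mono) auto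
        qed
        then have "norm Y / r \<le> (A * (norm w + d)) * norm w"
          using r by (simp add: A_def field_simps)
        also have "\<dots> \<le> (A * (2 * \<rho>)) * \<rho>"
          using w d nonneg \<rho> by (intro mult_mono mult_nonneg_nonneg) auto
        also have "\<dots> \<le> 1 / 2 * \<rho>"
          using \<rho> by (intro mult_right_mono) auto
        finally show "norm Y / r \<le> \<rho> / 2" by simp
        have fg: "norm (f s * g w s) \<le> K * G" if "s \<in> {0..l}" for s
          unfolding norm_mult using K[OF that] gG[OF w(1) that] K0 by (intro mult_mono) auto
        have "norm Z \<le> norm ((z\<^sup>2 - \<omega>\<^sup>2) * I 0 (\<lambda>s. f s * g w s)) + norm (\<i> * (z - \<omega>) * f l * g w l)"
          unfolding Z_def by (rule norm_triangle_ineq)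
        also have "\<dots> = norm (z\<^sup>2 - \<omega>\<^sup>2) * norm (I 0 (\<lambda>s. f s * g w s)) + d * norm (f l * g w l)"
          by (simp add: norm_mult d_def)
        also have "\<dots> \<le> d * L * (K * G * m) + d * (K * G)"
          using zL I_bound[OF S0 fg] fg[of l] l d L0 by (intro add_mono mult_mono) auto
        also have "\<dots> = d * R"
          by (simp add: R_def algebra_simps)
        also have "\<dots> \<le> (\<rho> * r * (norm \<omega>)\<^sup>2 / (8 * (R + 1))) * (R + 1)"
          using d nonneg by (intro mult_mono) auto
        also have "\<dots> = \<rho> * r * (norm \<omega>)\<^sup>2 / 8"
        proof -
          have "y / (8 * P) * P = y / 8" if "P \<noteq> 0" for y P :: real
            using that by simp
          then show ?thesis
            using nonneg(3) by (metis add_nonneg_pos less_irrefl zero_less_one)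
        qed
        also have "\<dots> = \<rho> / 2 * ((norm \<omega>)\<^sup>2 / 4 * r)"
          by simp
        also have "\<dots> \<le> \<rho> / 2 * (norm (z\<^sup>2) * r)"
          using z2 \<rho> r by (intro mult_left_mono mult_right_mono) auto
        finally show "norm Z / (norm (z\<^sup>2) * r) \<le> \<rho> / 2"
          using z0 r by (simp add: divide_le_eq)
      qed
      finally show ?thesis by simp
    qed
    \<comment> \<open>For \<open>E = \<real>\<close> Brouwer is applied to a real segment, which
      \<open>T\<close> must preserve: the solutions and moments are real there, and
      \<open>z - \<omega>\<close> is purely imaginary.\<close>
    have T_E: "T w \<in> E" if w: "w \<in> S" for w
    proof (cases "E = UNIV")
      case False
      with E zE have E: "E = \<real>" "Re \<omega> = 0" "Re z = 0" by auto
      have sq: "y\<^sup>2 = of_real (- ((Im y)\<^sup>2))" if "Re y = 0" for y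
        using that by (simp add: complex_eq_iff power2_eq_square)
      have rf: "Im (f s) = 0" if "s \<in> {0..l}" for s
        using volterra_real[OF b l _ that] f sq[OF E(2)] by metis
      have rg: "Im (g w s) = 0" if "s \<in> {0..l}" for s
        using volterra_real[OF BS[OF w] l _ that] g[OF w] sq[OF E(3)] by metis
      have rI: "Im (I v (\<lambda>s. f s * g w s)) = 0" if v: "v \<in> S" for v
      proof -
        have zero: "Im (B v s *\<^sub>R (f s * g w s)) = 0" for s
          using rf[of s] rg[of s] densitiesD(4)[OF BS[OF v], of s] by (cases "s \<in> {0..l}") auto
        have "Im (I v (\<lambda>s. f s * g w s)) = (LINT s|lborel. Im (B v s *\<^sub>R (f s * g w s)))"
          unfolding I_def by (intro integral_Im[symmetric] densities_integrable[OF BS[OF v]] continuous_intros fc gc w)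
        also have "\<dots> = 0"
          by (simp only: zero integral_zero)
        finally show ?thesis .
      qed
      have "\<i> * (z - \<omega>) \<in> \<real>" "z\<^sup>2 \<in> \<real>" "\<omega>\<^sup>2 \<in> \<real>"
        using E sq[of z] sq[of \<omega>] by (auto simp: complex_is_Real_iff)
      moreover have "f l \<in> \<real>" "g w l \<in> \<real>" "I w (\<lambda>s. f s * g w s) \<in> \<real>" "I 0 (\<lambda>s. f s * g w s) \<in> \<real>" "w \<in> \<real>"
        using rf[of l] rg[of l] rI[OF w] rI[OF S0] l S(1)[OF w] E(1) by (auto simp: complex_is_Real_iff)
      ultimately show ?thesis
        unfolding T_def H_def E(1) by (simp only: Reals_diff Reals_add Reals_mult Reals_divide Reals_of_real)
    qed simp
    define V where "V = E \<inter> cball 0 \<rho>"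
    have VS: "V \<subseteq> S"
      using \<rho> by (auto simp: V_def S_def)
    have "closed E" "convex E"
      using E by (auto simp: closed_complex_Reals convex_Reals)
    obtain w where w: "w \<in> V" "T w = w"
    proof (rule brouwer[of V T])
      show "compact V"
        unfolding V_def using \<open>closed E\<close> by (simp add: closed_Int_compact)
      show "convex V"
        unfolding V_def using \<open>convex E\<close> by (simp add: convex_Int)
      show "V \<noteq> {}"
        using E0 \<rho> by (auto simp: V_def)
      have "continuous_on S H"
        using H_cont by (simp add: continuous_on_def)
      then show "continuous_on V T"
        unfolding T_def using z0 r by (intro continuous_intros continuous_on_subset[OF _ VS]) auto
      show "T \<in> V \<rightarrow> V"
        using VS T_bound T_E by (auto simp: V_def subset_eq)
    qed
    then have wS: "w \<in> S" and Hw: "H w = 0"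
      using VS z0 r by (auto simp: T_def)
    have "z \<in> quasi_eigenvalues l (string_of l (B w))"
      by (rule quasi_eigenvalueI[OF b BS[OF wS] l f g[OF wS] \<omega> z0]) (use Hw in \<open>simp add: H_def I_def B0\<close>)
    then show ?thesis
      unfolding Sigma_family_def A1_eq using BS[OF wS] by blast
  qed
  with \<delta>(1) show ?thesis by blast
qed

section \<open>Convex combinations of densities and the directions they realise\<close>

lemma densities_combination:
  assumes b: "b \<in> densities l m"
    and c: "c1 \<in> densities l m" "c2 \<in> densities l m" "c3 \<in> densities l m" "c4 \<in> densities l m"
    and p: "0 \<le> p1" "0 \<le> p2" "0 \<le> p3" "0 \<le> p4" "p1 + p2 + p3 + p4 \<le> (1::real)"
  defines "B \<equiv> \<lambda>s. b s + (p1 * (c1 s - b s) + p2 * (c2 s - b s) + p3 * (c3 s - b s) + p4 * (c4 s - b s))"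
  shows "B \<in> densities l m"
proof -
  note D = densitiesD[OF b] and D1 = densitiesD[OF c(1)] and D2 = densitiesD[OF c(2)]
    and D3 = densitiesD[OF c(3)] and D4 = densitiesD[OF c(4)]
  define t where "t = 1 - (p1 + p2 + p3 + p4)"
  have t: "0 \<le> t"
    using p by (simp add: t_def)
  have B: "B s = t * b s + p1 * c1 s + p2 * c2 s + p3 * c3 s + p4 * c4 s" for s
    by (simp add: B_def t_def algebra_simps)
  have "(LINT s|lborel. B s) = t * (LINT s|lborel. b s) + p1 * (LINT s|lborel. c1 s) +
      p2 * (LINT s|lborel. c2 s) + p3 * (LINT s|lborel. c3 s) + p4 * (LINT s|lborel. c4 s)"
    unfolding B using D(1) D1(1) D2(1) D3(1) D4(1) by simp
  also have "\<dots> \<le> t * m + p1 * m + p2 * m + p3 * m + p4 * m"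
    using D(5) D1(5) D2(5) D3(5) D4(5) t p by (intro add_mono mult_left_mono) auto
  also have "\<dots> = m"
    by (simp add: t_def algebra_simps)
  finally have "(LINT s|lborel. B s) \<le> m" .
  moreover have "integrable lborel B"
    unfolding B[abs_def] using D(1) D1(1) D2(1) D3(1) D4(1) by simp
  moreover have "0 \<le> B s" for s
    unfolding B using t p D(3) D1(3) D2(3) D3(3) D4(3) by (intro add_nonneg_nonneg mult_nonneg_nonneg) auto
  moreover have "B s = 0" if "s \<notin> {0..l}" for s
    unfolding B using D(4)[OF that] D1(4)[OF that] D2(4)[OF that] D3(4)[OF that] D4(4)[OF that] by simp
  ultimately show ?thesis
    by (simp add: densities_def)
qed

lemma densities_convex_combination:
  assumes "b \<in> densities l m" "c \<in> densities l m" "0 \<le> t" "t \<le> (1::real)"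
  shows "(\<lambda>s. b s + t * (c s - b s)) \<in> densities l m"
  using densities_combination[OF assms(1,2,2,2,2) assms(3) order_refl order_refl order_refl] assms(4) by simp

text \<open>The densities realise the directions \<open>r\<close>, \<open>- r\<close>,
  \<open>\<i> * r\<close>, \<open>- \<i> * r\<close> of the moment. Splitting \<open>Re w\<close>
  and \<open>Im w\<close> into positive and negative parts gives nonnegative weights, and since the
  moment is affine in the density, the resulting family has moment exactly
  \<open>r * w\<close>.\<close>

lemma eigenvalues_near:
  fixes E :: "complex set"
  assumes b: "b \<in> densities l m" and l: "0 < l" and f: "volterra l b (\<omega>\<^sup>2) f"
    and \<omega>: "\<omega> \<in> quasi_eigenvalues l (string_of l b)"
    and E: "E = UNIV \<or> E = \<real> \<and> Re \<omega> = 0"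
    and r: "0 < r"
  defines "W \<equiv> \<lambda>c. (LINT s|lborel. c s *\<^sub>R (f s * f s)) - (LINT s|lborel. b s *\<^sub>R (f s * f s))"
  assumes c: "c1 \<in> densities l m" "c2 \<in> densities l m" "c3 \<in> densities l m" "c4 \<in> densities l m"
    and W: "W c1 = of_real r" "W c2 = - of_real r"
      "E = UNIV \<Longrightarrow> W c3 = \<i> * of_real r" "E = UNIV \<Longrightarrow> W c4 = - \<i> * of_real r"
  shows "\<exists>\<delta>>0. \<forall>z. norm (z - \<omega>) < \<delta> \<longrightarrow> (E = \<real> \<longrightarrow> Re z = 0) \<longrightarrow> z \<in> Sigma_family l (A1 l m)"
proof -
  note fc = volterra_continuous[OF f]
  note D = densitiesD[OF b] and D1 = densitiesD[OF c(1)] and D2 = densitiesD[OF c(2)]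
    and D3 = densitiesD[OF c(3)] and D4 = densitiesD[OF c(4)]
  define V where "V w s = max 0 (Re w) * (c1 s - b s) + max 0 (- Re w) * (c2 s - b s) +
    max 0 (Im w) * (c3 s - b s) + max 0 (- Im w) * (c4 s - b s)" for w s
  define B where "B w s = b s + V w s" for w s
  show ?thesis
  proof (rule perturbed_eigenvalue[OF b l f \<omega> E r, where B = B and \<Lambda> = "8 * m"])
    \<comment> \<open>Each of the four weights is 1-Lipschitz in \<open>w\<close>, and each
      difference \<open>c - b\<close> has total variation at most \<open>2 * m\<close>.\<close>
    show "0 \<le> 8 * m"
      using D(7) by simp
    show "B 0 = b"
      by (simp add: B_def V_def fun_eq_iff)
    \<comment> \<open>This fixes the radius 1/2: the weights add up to
      \<open>\<bar>Re w\<bar> + \<bar>Im w\<bar>\<close>, which must not exceed 1.\<close>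
    have small: "max 0 (Re w) + max 0 (- Re w) + max 0 (Im w) + max 0 (- Im w) \<le> 1" if "norm w \<le> 1 / 2" for w
      using that abs_Re_le_cmod[of w] abs_Im_le_cmod[of w] by linarith
    show "B w \<in> densities l m" if "norm w \<le> 1 / 2" for w
      unfolding B_def[abs_def] V_def
      using densities_combination[OF b c _ _ _ _ small[OF that]] by simp
    show "(LINT s|lborel. \<bar>B w s - B w' s\<bar>) \<le> 8 * m * norm (w - w')" for w w'
    proof -
      define n where "n = norm (w - w')"
      have n: "\<bar>max 0 (Re w) - max 0 (Re w')\<bar> \<le> n" "\<bar>max 0 (- Re w) - max 0 (- Re w')\<bar> \<le> n"
        "\<bar>max 0 (Im w) - max 0 (Im w')\<bar> \<le> n" "\<bar>max 0 (- Im w) - max 0 (- Im w')\<bar> \<le> n"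
        using abs_Re_le_cmod[of "w - w'"] abs_Im_le_cmod[of "w - w'"] by (auto simp: n_def)
      have i: "integrable lborel (\<lambda>s. n * (c1 s + b s) + n * (c2 s + b s) + n * (c3 s + b s) + n * (c4 s + b s))"
        using D(1) D1(1) D2(1) D3(1) D4(1) by simp
      have "(LINT s|lborel. \<bar>B w s - B w' s\<bar>) \<le>
          (LINT s|lborel. n * (c1 s + b s) + n * (c2 s + b s) + n * (c3 s + b s) + n * (c4 s + b s))"
      proof (rule integral_mono'[OF i])
        fix s
        have m: "\<bar>(p - p') * (c s - b s)\<bar> \<le> n * (c s + b s)" if "\<bar>p - p'\<bar> \<le> n" "c \<in> densities l m" for p p' c
          unfolding abs_mult using that densitiesD(3)[OF that(2), of s] D(3)[of s] by (intro mult_mono) auto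
        have add4: "\<bar>a1 + a2 + a3 + a4\<bar> \<le> e1 + e2 + e3 + e4"
          if "\<bar>a1\<bar> \<le> e1" "\<bar>a2\<bar> \<le> e2" "\<bar>a3\<bar> \<le> e3" "\<bar>a4\<bar> \<le> e4" for a1 a2 a3 a4 e1 e2 e3 e4 :: real
          using that by linarith
        have eq: "B w s - B w' s = (max 0 (Re w) - max 0 (Re w')) * (c1 s - b s) +
            (max 0 (- Re w) - max 0 (- Re w')) * (c2 s - b s) + (max 0 (Im w) - max 0 (Im w')) * (c3 s - b s) +
            (max 0 (- Im w) - max 0 (- Im w')) * (c4 s - b s)"
          by (simp add: B_def V_def left_diff_distrib)
        show "\<bar>B w s - B w' s\<bar> \<le> n * (c1 s + b s) + n * (c2 s + b s) + n * (c3 s + b s) + n * (c4 s + b s)"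
          unfolding eq by (rule add4[OF m[OF n(1) c(1)] m[OF n(2) c(2)] m[OF n(3) c(3)] m[OF n(4) c(4)]])
      next
        fix s
        show "0 \<le> n * (c1 s + b s) + n * (c2 s + b s) + n * (c3 s + b s) + n * (c4 s + b s)"
          using D(3)[of s] D1(3)[of s] D2(3)[of s] D3(3)[of s] D4(3)[of s] by (simp add: n_def)
      qed
      also have "\<dots> = n * ((LINT s|lborel. c1 s) + (LINT s|lborel. c2 s) + (LINT s|lborel. c3 s) +
          (LINT s|lborel. c4 s) + 4 * (LINT s|lborel. b s))"
        using D(1) D1(1) D2(1) D3(1) D4(1) by (simp add: algebra_simps)
      also have "\<dots> \<le> n * (8 * m)"
        using D(5) D1(5) D2(5) D3(5) D4(5) by (intro mult_left_mono) (auto simp: n_def)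
      finally show ?thesis by (simp add: n_def mult_ac)
    qed
    show "(LINT s|lborel. B w s *\<^sub>R (f s * f s)) - (LINT s|lborel. b s *\<^sub>R (f s * f s)) = of_real r * w"
      if w: "w \<in> E" for w
    proof -
      have i: "integrable lborel (\<lambda>s. c s *\<^sub>R (f s * f s))" if "c \<in> densities l m" for c
        by (intro densities_integrable[OF that] continuous_intros fc)
      note ib = i[OF b] and ic = i[OF c(1)] i[OF c(2)] i[OF c(3)] i[OF c(4)]
      have "(LINT s|lborel. B w s *\<^sub>R (f s * f s)) = (LINT s|lborel. b s *\<^sub>R (f s * f s) +
        (max 0 (Re w) *\<^sub>R (c1 s *\<^sub>R (f s * f s) - b s *\<^sub>R (f s * f s)) +
         max 0 (- Re w) *\<^sub>R (c2 s *\<^sub>R (f s * f s) - b s *\<^sub>R (f s * f s)) +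
         max 0 (Im w) *\<^sub>R (c3 s *\<^sub>R (f s * f s) - b s *\<^sub>R (f s * f s)) +
         max 0 (- Im w) *\<^sub>R (c4 s *\<^sub>R (f s * f s) - b s *\<^sub>R (f s * f s))))"
        by (simp add: B_def V_def scaleR_add_left scaleR_diff_left algebra_simps)
      also have "\<dots> = (LINT s|lborel. b s *\<^sub>R (f s * f s)) +
        (max 0 (Re w) *\<^sub>R W c1 + max 0 (- Re w) *\<^sub>R W c2 + max 0 (Im w) *\<^sub>R W c3 + max 0 (- Im w) *\<^sub>R W c4)"
        unfolding W_def
        by (simp only: Bochner_Integration.integral_add Bochner_Integration.integral_diff integral_scaleR_right
            Bochner_Integration.integrable_add Bochner_Integration.integrable_diff integrable_scaleR_right ib ic)
      finally have "(LINT s|lborel. B w s *\<^sub>R (f s * f s)) - (LINT s|lborel. b s *\<^sub>R (f s * f s)) =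
        max 0 (Re w) *\<^sub>R W c1 + max 0 (- Re w) *\<^sub>R W c2 + (max 0 (Im w) *\<^sub>R W c3 + max 0 (- Im w) *\<^sub>R W c4)"
        by simp
      also have "\<dots> = of_real r * w"
      proof -
        have "max 0 (Im w) *\<^sub>R W c3 + max 0 (- Im w) *\<^sub>R W c4 = \<i> * of_real (r * Im w)"
        proof (cases "E = UNIV")
          case True
          then show ?thesis
            unfolding W(3)[OF True] W(4)[OF True] by (simp add: max_def complex_eq_iff)
        next
          case False
          then have "Im w = 0"
            using E w by (auto simp: complex_is_Real_iff)
          then show ?thesis by simp
        qed
        moreover have "max 0 (Re w) *\<^sub>R W c1 + max 0 (- Re w) *\<^sub>R W c2 = of_real (r * Re w)"
          unfolding W by (simp add: max_def complex_eq_iff)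
        ultimately show ?thesis
          by (simp add: complex_eq_iff)
      qed
      finally show ?thesis .
    qed
  qed
qed

text \<open>Otherwise a line through 0 supports \<open>C\<close>, and
  \<open>\<eta> = - cnj a\<close> for its normal \<open>a\<close> contradicts \<open>sep\<close>, as
  \<open>Re (cnj a * v)\<close> is the inner product. A set with empty interior is treated apart: it
  lies in a line, which passes through 0.\<close>

lemma convex_zero_interior:
  fixes C :: "complex set"
  assumes C: "convex C" "0 \<in> C" and sep: "\<And>\<eta>. \<eta> \<noteq> 0 \<Longrightarrow> \<exists>v\<in>C. 0 < Re (\<eta> * v)"
  shows "0 \<in> interior C"
proof (rule ccontr)
  assume n: "0 \<notin> interior C"
  have "\<exists>a. a \<noteq> 0 \<and> (\<forall>v\<in>C. 0 \<le> inner a v)"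
  proof (cases "interior C = {}")
    case True
    then obtain a c where a: "a \<noteq> 0" "C \<subseteq> {x. inner a x = c}"
      using empty_interior_subset_hyperplane[OF C(1)] by blast
    then have "c = 0"
      using C(2) by force
    with a show ?thesis
      by (intro exI[of _ a]) auto
  next
    case False
    then have "0 \<notin> rel_interior C"
      using n by (simp add: rel_interior_nonempty_interior)
    then obtain a where "a \<noteq> 0" "\<And>v. v \<in> C \<Longrightarrow> inner a 0 \<le> inner a v"
      using supporting_hyperplane_rel_boundary[OF C] by metis
    then show ?thesis
      by (intro exI[of _ a]) simp
  qed
  then obtain a where a: "a \<noteq> 0" "\<And>v. v \<in> C \<Longrightarrow> 0 \<le> inner a v" by blast
  obtain v where v: "v \<in> C" "0 < Re (- cnj a * v)"
    using sep[of "- cnj a"] a(1) by auto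
  then show False
    using a(2)[OF v(1)] by (simp add: inner_complex_def)
qed

theorem theorem5p3:
  fixes l m :: real
  assumes "l > 0" and "m > 0"
  shows "\<not> (\<exists>(\<alpha> :: real) M. minimal_decay l (A1 l m) \<alpha> M)"
proof
  assume "\<exists>(\<alpha> :: real) M. minimal_decay l (A1 l m) \<alpha> M"
  then obtain \<alpha> M where M: "minimal_decay l (A1 l m) \<alpha> M" by blast
  define \<beta> where "\<beta> = beta_min l (A1 l m) \<alpha>"
  define \<omega> where "\<omega> = complex_of_real \<alpha> - \<i> * complex_of_real \<beta>"
  obtain b where b: "b \<in> densities l m" and \<omega>: "\<omega> \<in> quasi_eigenvalues l (string_of l b)"
  proof -
    have "M \<in> string_of l ` densities l m" "\<omega> \<in> quasi_eigenvalues l M"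
      using M unfolding minimal_decay_def A1_eq[symmetric] \<omega>_def \<beta>_def by simp_all
    then show ?thesis
      using that by (elim imageE) simp
  qed
  obtain f where f: "volterra l b (\<omega>\<^sup>2) f"
    using volterra_exists[OF b assms(1)] by blast
  note fc = volterra_continuous[OF f]
  note eig = quasi_eigenvalue_end[OF b assms(1) f \<omega>]
  define W where "W c = (LINT s|lborel. c s *\<^sub>R (f s * f s)) - (LINT s|lborel. b s *\<^sub>R (f s * f s))" for c
  have W_comb: "W (\<lambda>s. c s + t * (c' s - c s)) = W c + t *\<^sub>R (W c' - W c)"
    if "c \<in> densities l m" "c' \<in> densities l m" for c c' t
  proof -
    have i: "integrable lborel (\<lambda>s. c s *\<^sub>R (f s * f s))" if "c \<in> densities l m" for c
      by (intro densities_integrable[OF that] continuous_intros fc)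
    have eq: "(c s + t * (c' s - c s)) *\<^sub>R v = c s *\<^sub>R v + t *\<^sub>R (c' s *\<^sub>R v - c s *\<^sub>R v)" for s and v :: complex
      by (simp add: algebra_simps)
    have "(LINT s|lborel. (c s + t * (c' s - c s)) *\<^sub>R (f s * f s)) = (LINT s|lborel. c s *\<^sub>R (f s * f s)) +
        t *\<^sub>R ((LINT s|lborel. c' s *\<^sub>R (f s * f s)) - (LINT s|lborel. c s *\<^sub>R (f s * f s)))"
      unfolding eq
      by (simp only: Bochner_Integration.integral_add Bochner_Integration.integral_diff integral_scaleR_right
            Bochner_Integration.integrable_diff integrable_scaleR_right i[OF that(1)] i[OF that(2)])
    then show ?thesis
      by (simp add: W_def)
  qed
  have W_b: "W b = 0"
    by (simp add: W_def)
  have improve: "\<exists>c\<in>densities l m. 0 < Re (\<eta> * W c)" if "\<eta> \<noteq> 0" "Im (\<omega>\<^sup>2) \<noteq> 0 \<or> Re (\<eta> * \<omega>\<^sup>2) \<noteq> 0" for \<eta>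
    using improving_density[OF b assms(1) f eig(3) _ that] eig(2) by (simp add: W_def)
  have Re\<omega>: "Re \<omega> = \<alpha>" "Im \<omega> = - \<beta>"
    by (simp_all add: \<omega>_def)
  have \<beta>: "0 < \<beta>"
    using quasi_eigenvalue_Im[OF b assms(1) \<omega>] Re\<omega> by simp
  have "\<exists>\<delta>>0. \<forall>z. norm (z - \<omega>) < \<delta> \<longrightarrow> Re z = \<alpha> \<longrightarrow> z \<in> Sigma_family l (A1 l m)"
  proof (cases "\<alpha> = 0")
    case False
    define C where "C = W ` densities l m"
    \<comment> \<open>The imaginary part is \<open>- 2 * \<alpha> * \<beta>\<close>; hence
      \<open>improve\<close> is available for every nonzero \<open>\<eta>\<close>.\<close>
    have "Im (\<omega>\<^sup>2) \<noteq> 0"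
      using False \<beta> Re\<omega> by (simp add: power2_eq_square)
    moreover have "convex C"
      unfolding convex_alt
    proof (intro ballI allI impI)
      fix x y and u :: real
      assume "x \<in> C" "y \<in> C" and u: "0 \<le> u \<and> u \<le> 1"
      then obtain c c' where c: "c \<in> densities l m" "c' \<in> densities l m" and "x = W c" "y = W c'"
        by (auto simp: C_def)
      then have "(1 - u) *\<^sub>R x + u *\<^sub>R y = W (\<lambda>s. c s + u * (c' s - c s))"
        unfolding W_comb[OF c] by (simp add: algebra_simps)
      then show "(1 - u) *\<^sub>R x + u *\<^sub>R y \<in> C"
        using densities_convex_combination[OF c] u by (auto simp: C_def)
    qed
    moreover have "0 \<in> C"
      using b W_b by (force simp: C_def)
    ultimately have "0 \<in> interior C"
      using improve by (intro convex_zero_interior) (auto simp: C_def)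
    then obtain e where e: "e > 0" "ball 0 e \<subseteq> C"
      unfolding mem_interior by blast
    define r where "r = e / 2"
    have r: "0 < r" "r < e"
      using e(1) by (simp_all add: r_def)
    have "of_real r \<in> C" "- of_real r \<in> C" "\<i> * of_real r \<in> C" "- \<i> * of_real r \<in> C"
      using e(2) r by (auto simp: subset_eq norm_mult)
    then obtain c1 c2 c3 c4 where c: "c1 \<in> densities l m" "c2 \<in> densities l m" "c3 \<in> densities l m" "c4 \<in> densities l m"
      and Wc: "W c1 = of_real r" "W c2 = - of_real r" "W c3 = \<i> * of_real r" "W c4 = - \<i> * of_real r"
      unfolding C_def image_iff by metis
    have "\<exists>\<delta>>0. \<forall>z. norm (z - \<omega>) < \<delta> \<longrightarrow> ((UNIV :: complex set) = \<real> \<longrightarrow> Re z = 0) \<longrightarrow> z \<in> Sigma_family l (A1 l m)"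
      by (rule eigenvalues_near[where E = UNIV, OF b assms(1) f \<omega> _ r(1) c, folded W_def]) (use Wc in simp_all)
    moreover have "(UNIV :: complex set) \<noteq> \<real>"
      by (metis UNIV_I complex_is_Real_iff imaginary_unit.simps(2) zero_neq_one)
    ultimately show ?thesis by blast
  next
    case True
    have sq: "\<omega>\<^sup>2 = of_real (- (\<beta>\<^sup>2))"
      using True by (simp add: \<omega>_def power_mult_distrib)
    have rf: "Im (f s) = 0" if "s \<in> {0..l}" for s
      using volterra_real[OF b assms(1) _ that] f sq by metis
    have ImW: "Im (W c) = 0" if c: "c \<in> densities l m" for c
    proof -
      have "Im (LINT s|lborel. c s *\<^sub>R (f s * f s)) = 0" if c: "c \<in> densities l m" for c
      proof -
        have zero: "Im (c s *\<^sub>R (f s * f s)) = 0" for s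
          using rf[of s] densitiesD(4)[OF c, of s] by (cases "s \<in> {0..l}") auto
        have "Im (LINT s|lborel. c s *\<^sub>R (f s * f s)) = (LINT s|lborel. Im (c s *\<^sub>R (f s * f s)))"
          by (intro integral_Im[symmetric] densities_integrable[OF c] continuous_intros fc)
        also have "\<dots> = 0"
          by (simp only: zero integral_zero)
        finally show ?thesis .
      qed
      then show ?thesis using b c by (simp add: W_def)
    qed
    \<comment> \<open>Here \<open>\<omega>\<^sup>2 = - \<beta>\<^sup>2\<close> is real and nonzero,
      so \<open>improve\<close> serves the two real directions \<open>1\<close> and
      \<open>-1\<close>.\<close>
    obtain c where c: "c \<in> densities l m" "0 < Re (W c)"
      using improve[of 1] sq \<beta> by auto
    obtain c' where c': "c' \<in> densities l m" "Re (W c') < 0"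
      using improve[of "-1"] sq \<beta> by auto
    \<comment> \<open>The smaller of the two gains; scaling both competitors towards
      \<open>b\<close> yields the moments \<open>r\<close> and \<open>- r\<close> exactly.\<close>
    define r where "r = min (Re (W c)) (- Re (W c'))"
    have r: "0 < r" "r \<le> Re (W c)" "r \<le> - Re (W c')"
      using c c' by (auto simp: r_def)
    define c1 where "c1 s = b s + (r / Re (W c)) * (c s - b s)" for s
    define c2 where "c2 s = b s + (r / - Re (W c')) * (c' s - b s)" for s
    have c12: "c1 \<in> densities l m" "c2 \<in> densities l m"
      unfolding c1_def[abs_def] c2_def[abs_def] using r c c'
      by (intro densities_convex_combination b; simp add: divide_simps)+
    have W1: "W c1 = of_real r"
      unfolding c1_def[abs_def] W_comb[OF b c(1)] W_b using c ImW[OF c(1)] by (simp add: complex_eq_iff)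
    have W2: "W c2 = - of_real r"
      unfolding c2_def[abs_def] W_comb[OF b c'(1)] W_b using c' ImW[OF c'(1)] by (simp add: complex_eq_iff)
    have "(UNIV :: complex set) \<noteq> \<real>"
      by (metis UNIV_I complex_is_Real_iff imaginary_unit.simps(2) zero_neq_one)
    \<comment> \<open>\<open>b\<close> fills the slots of \<open>c3\<close> and \<open>c4\<close>,
      whose moment conditions concern \<open>E = UNIV\<close> only.\<close>
    then have "\<exists>\<delta>>0. \<forall>z. norm (z - \<omega>) < \<delta> \<longrightarrow> ((\<real> :: complex set) = \<real> \<longrightarrow> Re z = 0) \<longrightarrow> z \<in> Sigma_family l (A1 l m)"
      by (intro eigenvalues_near[where E = \<real>, OF b assms(1) f \<omega> _ r(1) c12 b b, folded W_def])
        (use True Re\<omega> W1 W2 in simp_all)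
    then show ?thesis
      using True by simp
  qed
  then obtain \<delta> where \<delta>: "0 < \<delta>" "\<And>z. norm (z - \<omega>) < \<delta> \<Longrightarrow> Re z = \<alpha> \<Longrightarrow> z \<in> Sigma_family l (A1 l m)"
    by blast
  define T where "T = {\<beta>. complex_of_real \<alpha> - \<i> * complex_of_real \<beta> \<in> Sigma_family l (A1 l m)}"
  have "\<beta> - \<delta> / 2 \<in> T"
  proof -
    define z where "z = complex_of_real \<alpha> - \<i> * complex_of_real (\<beta> - \<delta> / 2)"
    have "z - \<omega> = \<i> * of_real (\<delta> / 2)"
      by (simp add: z_def \<omega>_def complex_eq_iff)
    then have "norm (z - \<omega>) = \<bar>\<delta> / 2\<bar>"
      by (simp only: norm_mult norm_ii norm_of_real mult_1)
    moreover have "Re z = \<alpha>"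
      by (simp add: z_def)
    ultimately have "z \<in> Sigma_family l (A1 l m)"
      using \<delta> by auto
    then show ?thesis
      unfolding T_def z_def by (rule CollectI)
  qed
  \<comment> \<open>Without a lower bound \<open>Inf T\<close> would carry no information; 0 is a
    bound because quasi-eigenvalues have negative imaginary part.\<close>
  moreover have "bdd_below T"
  proof (rule bdd_belowI[of _ 0])
    fix x assume "x \<in> T"
    then obtain c where "c \<in> densities l m" "complex_of_real \<alpha> - \<i> * complex_of_real x \<in> quasi_eigenvalues l (string_of l c)"
      unfolding T_def Sigma_family_def A1_eq by blast
    from quasi_eigenvalue_Im[OF this(1) assms(1) this(2)] show "0 \<le> x" by simp
  qed
  ultimately have "Inf T \<le> \<beta> - \<delta> / 2"
    by (rule cInf_lower)
  then show False
    using \<delta>(1) by (simp add: \<beta>_def beta_min_def T_def)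
qed

end
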